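(* Let $\mu(dx)=Z e^{-V(x)}dx$ be a probability measure on $\mathbb{R}^n$ with $V$ smooth, $L=\Delta-\nabla V\cdot\nabla$ and $\Gamma(f)=|\nabla f|^2$. Suppose that there exist $W\ge 1$ in the domain of $L$ and constants $\lambda>0$, $b>0$, $R>0$ such that $$LW\le -\lambda W+b\,\mathbf{1}_{\{|x|\le R\}} .$$ Assume in addition that there exists a constant $\kappa_R$ such that for all $f\in\mathcal{A}$ $$\int_{|x|\le R} f^2\,d\mu\;\le\; \kappa_R\int\Gamma(f)\,d\mu+\mu(\{|x|\le R\})^{-1}\Big(\int_{|x|\le R} f\,d\mu\Big)^2 .$$ Then for all $f\in\mathcal{A}$ $$\mathrm{Var}_\mu(f)\;\le\; \frac{b\kappa_R+1}{\lambda}\int\Gamma(f)\,d\mu .$$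
   Context: $Z$ is the normalizing constant. $\mathcal{A}$ (the "nice" functions) is the algebra generated by the $C^\infty$ compactly supported functions on $\mathbb{R}^n$ and the constants. $L$ is regarded as the $\mu$-symmetric (self-adjoint) diffusion generator on $L^2(\mu)$ associated with the Dirichlet form $\mathcal{E}(f,g)=\int \nabla f\cdot\nabla g\,d\mu$ (the closure of this form on $\mathcal{A}$); its domain is $D(L)$. $\mathrm{Var}_\mu(f)=\int f^2d\mu-(\int f\,d\mu)^2$. *)

theory Defs
  imports "HOL-Probability.Probability"
begin

fun Ck :: "nat \<Rightarrow> (real ^ 'n \<Rightarrow> real) \<Rightarrow> bool" where
  "Ck 0 f \<longleftrightarrow> continuous_on UNIV f"
| "Ck (Suc k) f \<longleftrightarrow>
     (\<forall>x. f differentiable (at x)) \<and> (\<forall>v. Ck k (\<lambda>x. frechet_derivative f (at x) v))"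

definition smooth :: "(real ^ 'n \<Rightarrow> real) \<Rightarrow> bool" where
  "smooth f \<longleftrightarrow> (\<forall>k. Ck k f)"

definition partial :: "'n \<Rightarrow> (real ^ 'n \<Rightarrow> real) \<Rightarrow> real ^ 'n \<Rightarrow> real" where
  "partial i f x = frechet_derivative f (at x) (axis i 1)"

definition grad :: "(real ^ 'n \<Rightarrow> real) \<Rightarrow> real ^ 'n \<Rightarrow> real ^ 'n" where
  "grad f x = (\<chi> i. partial i f x)"

definition laplacian :: "(real ^ 'n \<Rightarrow> real) \<Rightarrow> real ^ 'n \<Rightarrow> real" where
  "laplacian f x = (\<Sum>i\<in>UNIV. partial i (partial i f) x)"

definition diff_op :: "(real ^ 'n \<Rightarrow> real) \<Rightarrow> (real ^ 'n \<Rightarrow> real) \<Rightarrow> real ^ 'n \<Rightarrow> real" where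
  "diff_op V f x = laplacian f x - grad V x \<bullet> grad f x"

definition carre_du_champ :: "(real ^ 'n \<Rightarrow> real) \<Rightarrow> real ^ 'n \<Rightarrow> real" where
  "carre_du_champ f x = (norm (grad f x))\<^sup>2"

definition test_functions :: "(real ^ 'n \<Rightarrow> real) set" where
  "test_functions = {f. smooth f \<and> compact (closure {x. f x \<noteq> 0})}"

inductive_set nice :: "(real ^ 'n \<Rightarrow> real) set" where
  test: "f \<in> test_functions \<Longrightarrow> f \<in> nice"
| const: "(\<lambda>_. c) \<in> nice"
| add: "f \<in> nice \<Longrightarrow> g \<in> nice \<Longrightarrow> (\<lambda>x. f x + g x) \<in> nice"
| mult: "f \<in> nice \<Longrightarrow> g \<in> nice \<Longrightarrow> (\<lambda>x. f x * g x) \<in> nice"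

definition gibbs :: "real \<Rightarrow> (real ^ 'n \<Rightarrow> real) \<Rightarrow> (real ^ 'n) measure" where
  "gibbs Z V = density lborel (\<lambda>x. ennreal (Z * exp (- V x)))"

definition Var :: "(real ^ 'n) measure \<Rightarrow> (real ^ 'n \<Rightarrow> real) \<Rightarrow> real" where
  "Var M f = (\<integral>x. (f x)\<^sup>2 \<partial>M) - (\<integral>x. f x \<partial>M)\<^sup>2"

definition L2 :: "(real ^ 'n) measure \<Rightarrow> (real ^ 'n \<Rightarrow> real) set" where
  "L2 M = {f \<in> borel_measurable M. integrable M (\<lambda>x. (f x)\<^sup>2)}"

definition dform ::
    "(real ^ 'n) measure \<Rightarrow> (real ^ 'n \<Rightarrow> real) \<Rightarrow> (real ^ 'n \<Rightarrow> real) \<Rightarrow> real" where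
  "dform M f g = (\<integral>x. grad f x \<bullet> grad g x \<partial>M)"

text \<open>
  The closure of the form \<^const>\<open>dform\<close> on \<^const>\<open>nice\<close>: its domain consists of the
  \<open>L\<^sup>2\<close>-limits of sequences of nice functions that are Cauchy for the form, and its values are
  the limits along such sequences, which do not depend on the sequences chosen since the form
  is closable (see \<open>closed_form_tendsto\<close>).
\<close>

definition form_approx ::
    "(real ^ 'n) measure \<Rightarrow> (real ^ 'n \<Rightarrow> real) \<Rightarrow> (nat \<Rightarrow> real ^ 'n \<Rightarrow> real) \<Rightarrow> bool" where
  "form_approx M f u \<longleftrightarrow>
     (\<forall>k. u k \<in> nice) \<and>
     (\<lambda>k. \<integral>x. (u k x - f x)\<^sup>2 \<partial>M) \<longlonglongrightarrow> 0 \<and>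
     (\<forall>e>0. \<exists>N. \<forall>j\<ge>N. \<forall>k\<ge>N. dform M (\<lambda>x. u j x - u k x) (\<lambda>x. u j x - u k x) < e)"

definition form_dom :: "(real ^ 'n) measure \<Rightarrow> (real ^ 'n \<Rightarrow> real) set" where
  "form_dom M = {f \<in> L2 M. \<exists>u. form_approx M f u}"

definition closed_form ::
    "(real ^ 'n) measure \<Rightarrow> (real ^ 'n \<Rightarrow> real) \<Rightarrow> (real ^ 'n \<Rightarrow> real) \<Rightarrow> real" where
  "closed_form M f g =
     (THE e. \<forall>u v. form_approx M f u \<longrightarrow> form_approx M g v \<longrightarrow>
        (\<lambda>k. dform M (u k) (v k)) \<longlonglongrightarrow> e)"

text \<open>
  The graph of the self-adjoint operator \<open>L\<close> on \<open>L\<^sup>2(M)\<close> associated with the closed form: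
  \<open>(f, h)\<close> belongs to it iff \<open>f\<close> is in the domain of \<open>L\<close> and \<open>L f = h\<close>. Elements of
  \<open>L\<^sup>2(M)\<close> are represented by functions, so \<open>h\<close> is determined only almost everywhere.
  On nice functions \<open>L\<close> is the differential operator \<open>\<Delta> - \<nabla>V \<bullet> \<nabla>\<close>
  (see \<open>generator_nice\<close>).
\<close>

definition generator ::
    "(real ^ 'n) measure \<Rightarrow> ((real ^ 'n \<Rightarrow> real) \<times> (real ^ 'n \<Rightarrow> real)) set" where
  "generator M =
     {(f, h). f \<in> form_dom M \<and> h \<in> L2 M \<and>
        (\<forall>g\<in>form_dom M. closed_form M f g = - (\<integral>x. h x * g x \<partial>M))}"

lemma Ck_Suc_imp: "Ck (Suc k) f \<Longrightarrow> Ck k f"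
proof (induction k arbitrary: f)
  case 0
  then show ?case
    by (auto intro!: differentiable_imp_continuous_on simp: differentiable_on_def)
next
  case (Suc k)
  then show ?case by (metis Ck.simps(2))
qed

lemma Ck_const: "Ck k (\<lambda>_. c)"
  by (induction k arbitrary: c) auto

lemma Ck_add: "Ck k f \<Longrightarrow> Ck k g \<Longrightarrow> Ck k (\<lambda>x. f x + g x)"
proof (induction k arbitrary: f g)
  case 0
  then show ?case by (auto intro: continuous_intros)
next
  case (Suc k)
  have "frechet_derivative (\<lambda>x. f x + g x) (at x) v =
      frechet_derivative f (at x) v + frechet_derivative g (at x) v" for x v
    using frechet_derivative_at[OF has_derivative_add[of f "frechet_derivative f (at x)" "at x"
        g "frechet_derivative g (at x)"]] Suc.prems
    by (metis (no_types, lifting) Ck.simps(2) frechet_derivative_works)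
  with Suc show ?case by auto
qed

lemma frechet_mult:
  fixes f g :: "real ^ 'n \<Rightarrow> real"
  assumes "f differentiable (at x)" "g differentiable (at x)"
  shows "frechet_derivative (\<lambda>x. f x * g x) (at x) v =
      f x * frechet_derivative g (at x) v + frechet_derivative f (at x) v * g x"
proof -
  have "((\<lambda>x. f x * g x) has_derivative (\<lambda>v. f x * frechet_derivative g (at x) v + frechet_derivative f (at x) v * g x)) (at x)"
    using assms by (intro has_derivative_mult) (auto simp: frechet_derivative_works)
  from frechet_derivative_at[OF this] show ?thesis by (metis (no_types, lifting))
qed

lemma Ck_mult: "Ck k f \<Longrightarrow> Ck k g \<Longrightarrow> Ck k (\<lambda>x. f x * g x)"
proof (induction k arbitrary: f g)
  case 0
  then show ?case by (auto intro: continuous_intros)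
next
  case (Suc k)
  have "frechet_derivative (\<lambda>x. f x * g x) (at x) v =
      f x * frechet_derivative g (at x) v + frechet_derivative f (at x) v * g x" for x v
    using Suc.prems by (intro frechet_mult) auto
  moreover have "Ck k f" "Ck k g" using Suc.prems Ck_Suc_imp by auto
  ultimately show ?case using Suc by (auto intro!: Ck_add differentiable_mult)
qed

lemma smooth_differentiable: "smooth f \<Longrightarrow> f differentiable (at x)"
  unfolding smooth_def by (metis Ck.simps(2))

lemma smooth_partial: "smooth f \<Longrightarrow> smooth (partial i f)"
  unfolding smooth_def partial_def[abs_def] by (metis Ck.simps(2))

lemma smooth_continuous: "smooth f \<Longrightarrow> continuous_on UNIV f"
  unfolding smooth_def by (metis Ck.simps(1))

lemma nice_smooth: "f \<in> nice \<Longrightarrow> smooth f"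
  by (induction rule: nice.induct)
     (auto simp: test_functions_def smooth_def Ck_const Ck_add Ck_mult)

lemma nice_const_outside: "f \<in> nice \<Longrightarrow> \<exists>c S. compact S \<and> (\<forall>x. x \<notin> S \<longrightarrow> f x = c)"
proof (induction rule: nice.induct)
  case (test f)
  then show ?case
    by (intro exI[of _ 0] exI[of _ "closure {x. f x \<noteq> 0}"])
       (auto simp: test_functions_def intro: closure_subset[THEN subsetD])
next
  case (const c)
  then show ?case by (intro exI[of _ c] exI[of _ "{}"]) auto
next
  case (add f g)
  then obtain c S d T where "compact S" "\<forall>x. x \<notin> S \<longrightarrow> f x = c" "compact T" "\<forall>x. x \<notin> T \<longrightarrow> g x = d"
    by blast
  then show ?case by (intro exI[of _ "c + d"] exI[of _ "S \<union> T"]) auto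
next
  case (mult f g)
  then obtain c S d T where "compact S" "\<forall>x. x \<notin> S \<longrightarrow> f x = c" "compact T" "\<forall>x. x \<notin> T \<longrightarrow> g x = d"
    by blast
  then show ?case by (intro exI[of _ "c * d"] exI[of _ "S \<union> T"]) auto
qed

lemma nice_diff: "f \<in> nice \<Longrightarrow> g \<in> nice \<Longrightarrow> (\<lambda>x. f x - g x) \<in> nice"
  using nice.add[OF _ nice.mult[OF nice.const[of "-1"]], of f g] by simp

lemma partial_eq_0_outside:
  assumes "compact S" "\<forall>x. x \<notin> S \<longrightarrow> f x = c" "x \<notin> S"
  shows "partial i f x = 0"
proof -
  have "(f has_derivative (\<lambda>_. 0)) (at x)"
    by (rule has_derivative_transform_within_open[of "\<lambda>_. c" _ _ _ "- S"])
       (use assms in \<open>auto intro: compact_imp_closed\<close>)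
  from frechet_derivative_at[OF this] show ?thesis unfolding partial_def by metis
qed

lemma nice_partials_outside:
  assumes "f \<in> nice"
  obtains S where "compact S" "\<And>x i. x \<notin> S \<Longrightarrow> partial i f x = 0"
    "\<And>x i j. x \<notin> S \<Longrightarrow> partial i (partial j f) x = 0"
proof -
  obtain c S where S: "compact S" "\<forall>x. x \<notin> S \<longrightarrow> f x = c"
    using nice_const_outside[OF assms] by blast
  have 1: "partial i f x = 0" if "x \<notin> S" for x i
    using partial_eq_0_outside[OF S that] .
  have "partial i (partial j f) x = 0" if "x \<notin> S" for x i j
    using partial_eq_0_outside[of S "partial j f" 0 x i] S(1) 1 that by auto
  with 1 S show thesis using that by blast
qed

lemma bounded_of_outside:
  fixes f :: "real ^ 'n \<Rightarrow> real"
  assumes "continuous_on UNIV f" "compact S" "\<forall>x. x \<notin> S \<longrightarrow> f x = c"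
  shows "\<exists>B. \<forall>x. \<bar>f x\<bar> \<le> B"
proof -
  have "compact (f ` S)"
    using assms by (intro compact_continuous_image) (auto intro: continuous_on_subset)
  then obtain B where B: "\<And>x. x \<in> S \<Longrightarrow> \<bar>f x\<bar> \<le> B"
    by (metis bounded_iff compact_imp_bounded imageI real_norm_def)
  have "\<bar>f x\<bar> \<le> max B \<bar>c\<bar>" for x
    using B[of x] assms(3) by (cases "x \<in> S") auto
  then show ?thesis by blast
qed

lemma nice_bounded:
  assumes "f \<in> nice"
  shows "\<exists>B. \<forall>x. \<bar>f x\<bar> \<le> B"
proof -
  obtain c S where "compact S" "\<forall>x. x \<notin> S \<longrightarrow> f x = c"
    using nice_const_outside[OF assms] by blast
  from bounded_of_outside[OF smooth_continuous[OF nice_smooth[OF assms]] this] show ?thesis .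
qed

lemma nice_partial_bounded:
  assumes "f \<in> nice"
  shows "\<exists>B. \<forall>x. \<bar>partial i f x\<bar> \<le> B"
proof -
  obtain S where S: "compact S" "\<And>x i. x \<notin> S \<Longrightarrow> partial i f x = 0"
    "\<And>x i j. x \<notin> S \<Longrightarrow> partial i (partial j f) x = 0"
    using that by (rule nice_partials_outside[OF assms])
  show ?thesis
    by (rule bounded_of_outside[OF smooth_continuous[OF smooth_partial[OF nice_smooth[OF assms]]] S(1)])
       (use S(2) in blast)
qed

lemma integrable_cont_compact:
  fixes f :: "real ^ 'n \<Rightarrow> real"
  assumes "continuous_on UNIV f" "compact S" "\<forall>x. x \<notin> S \<longrightarrow> f x = 0"
  shows "integrable lborel f"
proof -
  have "integrable lborel (\<lambda>x. indicator S x *\<^sub>R f x)"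
    using assms by (intro borel_integrable_compact) (auto intro: continuous_on_subset)
  also have "(\<lambda>x. indicator S x *\<^sub>R f x) = f"
    using assms(3) by (auto simp: indicator_def fun_eq_iff)
  finally show ?thesis .
qed

lemma integral_partial_eq_0:
  fixes F :: "real ^ 'n \<Rightarrow> real"
  assumes diff: "\<And>x. F differentiable (at x)"
    and cont: "continuous_on UNIV (partial i F)"
    and S: "compact S" "\<forall>x. x \<notin> S \<longrightarrow> F x = 0"
  shows "(\<integral>x. partial i F x \<partial>lborel) = 0"
proof -
  define e where "e = (axis i 1 :: real ^ 'n)"
  have ne: "norm e = 1" by (simp add: e_def)
  have cF: "continuous_on UNIV F"
    using diff by (auto intro!: differentiable_imp_continuous_on simp: differentiable_on_def)
  have P0: "\<forall>x. x \<notin> S \<longrightarrow> partial i F x = 0"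
    using partial_eq_0_outside[OF S] by blast
  obtain B where B: "\<And>x. \<bar>partial i F x\<bar> \<le> B"
    using bounded_of_outside[OF cont S(1) P0] by blast
  have B0: "B \<ge> 0" using B[of 0] by linarith
  define T where "T = {x + y |x y. x \<in> S \<and> y \<in> cball (0::real ^ 'n) 1}"
  have cT: "compact T" unfolding T_def using S(1) by (intro compact_sums) auto
  have intF: "integrable lborel F" using integrable_cont_compact[OF cF S] .
  define t where "t k = inverse (real (Suc k))" for k
  have t: "t k > 0" "t k \<le> 1" for k by (auto simp: t_def field_simps)
  define D where "D k x = (F (x + t k *\<^sub>R e) - F x) / t k" for k x
  have line: "((\<lambda>s. F (x + s *\<^sub>R e)) has_real_derivative partial i F (x + s *\<^sub>R e)) (at s)" for x s
  proof -
    have lin: "linear (frechet_derivative F (at (x + s *\<^sub>R e)))"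
      using diff by (rule linear_frechet_derivative)
    have "((\<lambda>s. F (x + s *\<^sub>R e)) has_derivative (\<lambda>h. frechet_derivative F (at (x + s *\<^sub>R e)) (h *\<^sub>R e))) (at s)"
      by (rule has_derivative_compose[where f = "\<lambda>s. x + s *\<^sub>R e"])
         (auto intro!: derivative_eq_intros diff simp: frechet_derivative_works[symmetric])
    then show ?thesis
      unfolding has_field_derivative_def partial_def e_def[symmetric] linear_scale[OF lin]
      by (rule has_derivative_eq_rhs) (simp add: fun_eq_iff)
  qed
  have mv: "\<exists>s. 0 < s \<and> s < t k \<and> D k x = partial i F (x + s *\<^sub>R e)" for k x
  proof -
    have "\<exists>z>0. z < t k \<and> F (x + t k *\<^sub>R e) - F (x + 0 *\<^sub>R e) = (t k - 0) * partial i F (x + z *\<^sub>R e)"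
      using t by (intro MVT2 line) auto
    then show ?thesis using t[of k] by (auto simp: D_def field_simps)
  qed
  have bound: "\<bar>D k x\<bar> \<le> B * indicator T x" for k x
  proof -
    obtain s where s: "0 < s" "s < t k" "D k x = partial i F (x + s *\<^sub>R e)" using mv by blast
    show ?thesis
    proof (cases "x \<in> T")
      case False
      have "x + s *\<^sub>R e \<notin> S"
      proof
        assume "x + s *\<^sub>R e \<in> S"
        moreover have "- (s *\<^sub>R e) \<in> cball 0 1" using s t(2)[of k] by (simp add: ne)
        moreover have "x = (x + s *\<^sub>R e) + (- (s *\<^sub>R e))" by simp
        ultimately have "x \<in> T" unfolding T_def by blast
        with False show False ..
      qed
      then show ?thesis using P0 s(3) False by simp
    qed (use B s(3) in auto)
  qed
  have int0: "(\<integral>x. D k x \<partial>lborel) = 0" for k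
  proof -
    have d: "lborel = distr lborel borel (\<lambda>x. t k *\<^sub>R e + x)"
      by (rule lborel_distr_plus[symmetric])
    have m: "(\<lambda>x. t k *\<^sub>R e + x) \<in> measurable lborel borel" by measurable
    have mF: "F \<in> borel_measurable borel" using intF by auto
    have 1: "integrable lborel (\<lambda>x. F (t k *\<^sub>R e + x))"
      using intF by (subst (asm) d, subst (asm) integrable_distr_eq[OF m mF])
    have 2: "(\<integral>x. F (t k *\<^sub>R e + x) \<partial>lborel) = (\<integral>x. F x \<partial>lborel)"
      by (subst (2) d, subst integral_distr[OF m mF]) simp
    have "(\<integral>x. D k x \<partial>lborel) = (\<integral>x. F (t k *\<^sub>R e + x) - F x \<partial>lborel) / t k"
      unfolding D_def by (simp add: add.commute)
    also have "(\<integral>x. F (t k *\<^sub>R e + x) - F x \<partial>lborel) = 0"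
      using 1 2 intF by (subst Bochner_Integration.integral_diff) auto
    finally show ?thesis by simp
  qed
  have "(\<lambda>k. \<integral>x. D k x \<partial>lborel) \<longlonglongrightarrow> (\<integral>x. partial i F x \<partial>lborel)"
  proof (rule integral_dominated_convergence[where w = "\<lambda>x. B * indicator T x"])
    show "partial i F \<in> borel_measurable lborel"
      using cont by (simp add: borel_measurable_continuous_onI)
    show "D k \<in> borel_measurable lborel" for k
      unfolding D_def using cF by (auto intro!: borel_measurable_continuous_onI continuous_intros
         continuous_on_compose2[OF cF] simp: less_imp_neq[OF t(1)] t(1)[THEN less_imp_neq, symmetric])
    have "emeasure lborel T < \<infinity>" using cT by (rule emeasure_compact_finite)
    moreover have "T \<in> sets lborel" using cT by (simp add: borel_compact)
    ultimately show "integrable lborel (\<lambda>x. B * indicator T x)"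
      by (intro integrable_mult_right integrable_real_indicator) auto
    have "(\<lambda>k. D k x) \<longlonglongrightarrow> partial i F x" for x
    proof -
      have "((\<lambda>h. (F (x + (0 + h) *\<^sub>R e) - F (x + 0 *\<^sub>R e)) / h) \<longlongrightarrow> partial i F (x + 0 *\<^sub>R e)) (at 0)"
        using line[of x 0] unfolding DERIV_def .
      then have lim: "((\<lambda>h. (F (x + h *\<^sub>R e) - F x) / h) \<longlongrightarrow> partial i F x) (at 0)" by simp
      have "filterlim t (at 0) sequentially"
        unfolding filterlim_at using LIMSEQ_inverse_real_of_nat t(1)
        by (auto simp: t_def[abs_def])
      from filterlim_compose[OF lim this] show ?thesis by (simp add: D_def)
    qed
    then show "AE x in lborel. (\<lambda>k. D k x) \<longlonglongrightarrow> partial i F x" by simp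
    show "AE x in lborel. norm (D k x) \<le> B * indicator T x" for k using bound by auto
  qed
  then show ?thesis unfolding int0 by (simp add: LIMSEQ_const_iff)
qed

lemma partial_mult:
  assumes "f differentiable (at x)" "g differentiable (at x)"
  shows "partial i (\<lambda>x. f x * g x) x = f x * partial i g x + partial i f x * g x"
  unfolding partial_def using frechet_mult[OF assms] .

lemma partial_exp:
  assumes "V differentiable (at x)"
  shows "(\<lambda>x. Z * exp (- V x)) differentiable (at x)"
    "partial i (\<lambda>x. Z * exp (- V x)) x = - partial i V x * (Z * exp (- V x))"
proof -
  have "((\<lambda>x. Z * exp (- V x)) has_derivative
      (\<lambda>v. - frechet_derivative V (at x) v * (Z * exp (- V x)))) (at x)"
    using assms unfolding frechet_derivative_works
    by (auto intro!: derivative_eq_intros)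
  then show "(\<lambda>x. Z * exp (- V x)) differentiable (at x)"
    "partial i (\<lambda>x. Z * exp (- V x)) x = - partial i V x * (Z * exp (- V x))"
    unfolding partial_def using frechet_derivative_at by (blast intro: differentiableI, metis (no_types, lifting))
qed

lemma inner_grad: "grad f x \<bullet> grad g x = (\<Sum>i\<in>UNIV. partial i f x * partial i g x)"
  by (simp add: grad_def inner_vec_def)

lemma gibbs_pos:
  assumes "prob_space (gibbs Z V)"
  shows "Z > 0"
proof (rule ccontr)
  assume "\<not> Z > 0"
  then have "gibbs Z V = density lborel (\<lambda>_. 0)"
    unfolding gibbs_def by (intro arg_cong2[where f = density] ext ennreal_neg refl)
      (auto simp: mult_nonpos_nonneg)
  then have "emeasure (gibbs Z V) (space (gibbs Z V)) = 0"
    by (simp add: emeasure_density)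
  with prob_space.emeasure_space_1[OF assms] show False by simp
qed

lemma integral_gibbs:
  fixes f V :: "real ^ 'n \<Rightarrow> real"
  assumes "smooth V" "Z > 0" "continuous_on UNIV f"
  shows "(\<integral>x. f x \<partial>gibbs Z V) = (\<integral>x. Z * exp (- V x) * f x \<partial>lborel)"
proof -
  have "(\<lambda>x. Z * exp (- V x)) \<in> borel_measurable lborel" "f \<in> borel_measurable lborel"
    using assms smooth_continuous
    by (auto intro!: borel_measurable_continuous_onI continuous_intros)
  then show ?thesis unfolding gibbs_def using assms(2) by (subst integral_density) auto
qed

lemma dform_by_parts:
  fixes u f V :: "real ^ 'n \<Rightarrow> real"
  assumes "smooth V" "prob_space (gibbs Z V)" "u \<in> nice" "f \<in> nice"
  shows "dform (gibbs Z V) u f = - (\<integral>x. u x * diff_op V f x \<partial>gibbs Z V)"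
proof -
  note Z = gibbs_pos[OF assms(2)]
  define w where "w x = Z * exp (- V x)" for x
  have dw: "w differentiable (at x)" "partial i w x = - partial i V x * w x" for x i
    using partial_exp[OF smooth_differentiable[OF assms(1)]] unfolding w_def[abs_def] by blast+
  have cw: "continuous_on UNIV w"
    using smooth_continuous[OF assms(1)] unfolding w_def[abs_def] by (intro continuous_intros)
  note su = nice_smooth[OF assms(3)] note sf = nice_smooth[OF assms(4)]
  note cont = cw smooth_continuous[OF su] smooth_continuous[OF smooth_partial[OF su]]
    smooth_continuous[OF smooth_partial[OF sf]] smooth_continuous[OF smooth_partial[OF smooth_partial[OF sf]]]
    smooth_continuous[OF smooth_partial[OF assms(1)]]
  obtain S where S: "compact S" "\<And>x i. x \<notin> S \<Longrightarrow> partial i f x = 0"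
    "\<And>x i j. x \<notin> S \<Longrightarrow> partial i (partial j f) x = 0"
    using that by (rule nice_partials_outside[OF assms(4)])
  define F where "F i x = u x * (partial i f x * w x)" for i x
  define G where "G i x = w x * (partial i u x * partial i f x)" for i x
  define H where "H i x = w x * (u x * (partial i (partial i f) x - partial i V x * partial i f x))" for i x
  have dF: "F i differentiable (at x)" for i x unfolding F_def[abs_def]
    by (intro differentiable_mult dw smooth_differentiable su smooth_partial sf)
  have pF: "partial i (F i) = (\<lambda>x. G i x + H i x)" for i
  proof
    fix x
    have "partial i (F i) x = u x * partial i (\<lambda>x. partial i f x * w x) x + partial i u x * (partial i f x * w x)"
      unfolding F_def[abs_def]
      by (intro partial_mult differentiable_mult dw smooth_differentiable su smooth_partial sf)
    also have "partial i (\<lambda>x. partial i f x * w x) x = partial i f x * partial i w x + partial i (partial i f) x * w x"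
      by (intro partial_mult dw smooth_differentiable smooth_partial sf)
    finally show "partial i (F i) x = G i x + H i x"
      by (simp add: G_def H_def dw(2) algebra_simps)
  qed
  have cG: "continuous_on UNIV (G i)" and cH: "continuous_on UNIV (H i)" for i
    unfolding G_def[abs_def] H_def[abs_def] by (intro continuous_intros cont)+
  have iG: "integrable lborel (G i)" and iH: "integrable lborel (H i)" for i
    using S by (auto intro!: integrable_cont_compact[OF _ S(1)] cG cH simp: G_def H_def)
  have "(\<integral>x. partial i (F i) x \<partial>lborel) = 0" for i
    by (rule integral_partial_eq_0[OF dF _ S(1)])
       (use S in \<open>auto simp: pF F_def intro!: continuous_intros cG cH\<close>)
  then have GH: "(\<integral>x. G i x \<partial>lborel) = - (\<integral>x. H i x \<partial>lborel)" for i
    unfolding pF using iG iH by (simp add: add_eq_0_iff2)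
  have "dform (gibbs Z V) u f = (\<integral>x. (\<Sum>i\<in>UNIV. G i x) \<partial>lborel)"
    unfolding dform_def inner_grad
    by (subst integral_gibbs[OF assms(1) Z])
       (auto intro!: continuous_intros cont simp: G_def w_def sum_distrib_left)
  also have "\<dots> = - (\<Sum>i\<in>UNIV. \<integral>x. H i x \<partial>lborel)"
    using iG by (simp add: GH sum_negf)
  also have "(\<Sum>i\<in>UNIV. \<integral>x. H i x \<partial>lborel) = (\<integral>x. (\<Sum>i\<in>UNIV. H i x) \<partial>lborel)"
    using iH by simp
  also have "\<dots> = (\<integral>x. u x * diff_op V f x \<partial>gibbs Z V)"
    unfolding diff_op_def laplacian_def inner_grad
    by (subst integral_gibbs[OF assms(1) Z])
       (auto intro!: continuous_intros cont simp: H_def w_def sum_distrib_left sum_subtractf right_diff_distrib)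
  finally show ?thesis .
qed

lemma diff_op_bounded:
  fixes f V :: "real ^ 'n \<Rightarrow> real"
  assumes "smooth V" "f \<in> nice"
  shows "continuous_on UNIV (diff_op V f)" "\<exists>B. \<forall>x. \<bar>diff_op V f x\<bar> \<le> B"
proof -
  note sf = nice_smooth[OF assms(2)]
  obtain S where S: "compact S" "\<And>x i. x \<notin> S \<Longrightarrow> partial i f x = 0"
    "\<And>x i j. x \<notin> S \<Longrightarrow> partial i (partial j f) x = 0"
    using that by (rule nice_partials_outside[OF assms(2)])
  show c: "continuous_on UNIV (diff_op V f)"
    unfolding diff_op_def[abs_def] laplacian_def inner_grad
    by (intro continuous_intros smooth_continuous smooth_partial sf assms(1))
  show "\<exists>B. \<forall>x. \<bar>diff_op V f x\<bar> \<le> B"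
    by (rule bounded_of_outside[OF c S(1), of 0])
       (use S in \<open>auto simp: diff_op_def laplacian_def inner_grad\<close>)
qed

lemma sets_gibbs[simp, measurable_cong]: "sets (gibbs Z V) = sets borel"
  by (simp add: gibbs_def)

context
  fixes V :: "real ^ 'n \<Rightarrow> real" and Z :: real and M
  assumes V: "smooth V" and ps: "prob_space (gibbs Z V)" and M: "M = gibbs Z V"
begin

interpretation prob_space M using ps M by simp

lemma bounded_integrable:
  assumes "continuous_on UNIV f" "\<exists>B. \<forall>x. \<bar>f x\<bar> \<le> B"
  shows "integrable M (f :: real ^ 'n \<Rightarrow> real)"
proof -
  have "f \<in> borel_measurable M"
    using borel_measurable_continuous_onI[OF assms(1)] by (simp add: M gibbs_def)
  then show ?thesis using assms(2) integrable_const_bound[of f] by (metis AE_I2 real_norm_def)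
qed

lemma bounded_mult:
  assumes "\<exists>B. \<forall>x. \<bar>f x :: real\<bar> \<le> B" "\<exists>B. \<forall>x. \<bar>g x\<bar> \<le> B"
  shows "\<exists>B. \<forall>x. \<bar>f x * g x\<bar> \<le> B"
proof -
  obtain B C where "\<forall>x. \<bar>f x\<bar> \<le> B" "\<forall>x. \<bar>g x\<bar> \<le> C" using assms by blast
  then have "\<bar>f x * g x\<bar> \<le> B * C" for x
    unfolding abs_mult using abs_ge_zero order_trans by (intro mult_mono) blast+
  then show ?thesis by blast
qed

lemma integrable_grad:
  assumes "f \<in> nice" "g \<in> nice"
  shows "integrable M (\<lambda>x. grad f x \<bullet> grad g x)"
  unfolding inner_grad
  by (intro Bochner_Integration.integrable_sum bounded_integrable bounded_mult nice_partial_bounded assms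
      continuous_intros smooth_continuous smooth_partial nice_smooth)

lemma nice_differentiable: "f \<in> nice \<Longrightarrow> f differentiable (at x)"
  using nice_smooth smooth_differentiable by blast

lemma grad_lin:
  assumes "f \<in> nice" "g \<in> nice"
  shows "grad (\<lambda>x. f x + c * g x) x = grad f x + c *\<^sub>R grad g x"
proof -
  have "((\<lambda>x. f x + c * g x) has_derivative (\<lambda>v. frechet_derivative f (at x) v + c * frechet_derivative g (at x) v)) (at x)"
    using assms[THEN nice_differentiable] unfolding frechet_derivative_works
    by (intro has_derivative_add has_derivative_mult_right) auto
  from frechet_derivative_at[OF this, symmetric]
  show ?thesis by (simp add: grad_def partial_def vec_eq_iff)
qed

lemma grad_diff:
  assumes "f \<in> nice" "g \<in> nice"
  shows "grad (\<lambda>x. f x - g x) x = grad f x - grad g x"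
  using grad_lin[OF assms, of "-1"] by simp

lemma dform_sym: "dform M f g = dform M g f"
  by (simp add: dform_def inner_commute)

lemma dform_diff:
  assumes "f \<in> nice" "g \<in> nice" "h \<in> nice"
  shows "dform M (\<lambda>x. f x - g x) h = dform M f h - dform M g h"
  unfolding dform_def using assms
  by (simp add: grad_diff inner_diff_left integrable_grad)

lemma dform_diff_right:
  assumes "f \<in> nice" "g \<in> nice" "h \<in> nice"
  shows "dform M h (\<lambda>x. f x - g x) = dform M h f - dform M h g"
  using dform_diff[OF assms] by (simp add: dform_sym)

lemma dform_nonneg: "dform M f f \<ge> 0"
  by (simp add: dform_def)

lemma dform_CS:
  assumes "f \<in> nice" "g \<in> nice"
  shows "\<bar>dform M f g\<bar> \<le> sqrt (dform M f f) * sqrt (dform M g g)"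
proof -
  let ?a = "dform M f f" and ?b = "dform M f g" and ?c = "dform M g g"
  have q: "?a + 2 * t * ?b + t\<^sup>2 * ?c \<ge> 0" for t
  proof -
    have "0 \<le> (\<integral>x. (grad f x + t *\<^sub>R grad g x) \<bullet> (grad f x + t *\<^sub>R grad g x) \<partial>M)"
      by simp
    also have "(\<lambda>x. (grad f x + t *\<^sub>R grad g x) \<bullet> (grad f x + t *\<^sub>R grad g x)) =
       (\<lambda>x. grad f x \<bullet> grad f x + 2 * t * (grad f x \<bullet> grad g x) + t\<^sup>2 * (grad g x \<bullet> grad g x))"
      by (auto simp: inner_add_left inner_add_right inner_commute power2_eq_square algebra_simps)
    also have "integral\<^sup>L M \<dots> = ?a + 2 * t * ?b + t\<^sup>2 * ?c"
      unfolding dform_def using assms by (simp add: integrable_grad)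
    finally show ?thesis .
  qed
  have "?b\<^sup>2 \<le> ?a * ?c"
  proof (cases "?c = 0")
    case True
    have "?b = 0"
    proof (rule ccontr)
      assume "?b \<noteq> 0"
      then show False using q[of "- (?a + 1) / (2 * ?b)"] True by (simp add: field_simps)
    qed
    then show ?thesis using True by simp
  next
    case False
    then have c: "?c > 0" using dform_nonneg[of g] by simp
    have "?a + 2 * (- ?b / ?c) * ?b + (- ?b / ?c)\<^sup>2 * ?c = ?a - ?b\<^sup>2 / ?c"
      using c by (simp add: field_simps power2_eq_square)
    then have "?b\<^sup>2 / ?c \<le> ?a" using q[of "- ?b / ?c"] by simp
    then show ?thesis using c by (simp add: field_simps)
  qed
  then have "sqrt (?b\<^sup>2) \<le> sqrt (?a * ?c)" by (rule real_sqrt_le_mono)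
  then show ?thesis by (simp add: real_sqrt_mult)
qed

definition "fnorm f = sqrt (dform M f f)"

lemma fnorm_nonneg: "fnorm f \<ge> 0" by (simp add: fnorm_def dform_nonneg)

lemma CS: "f \<in> nice \<Longrightarrow> g \<in> nice \<Longrightarrow> \<bar>dform M f g\<bar> \<le> fnorm f * fnorm g"
  unfolding fnorm_def by (rule dform_CS)

lemma fnorm_triangle:
  assumes "f \<in> nice" "g \<in> nice"
  shows "fnorm (\<lambda>x. f x - g x) \<le> fnorm f + fnorm g"
proof -
  have "dform M (\<lambda>x. f x - g x) (\<lambda>x. f x - g x) = dform M f f - 2 * dform M f g + dform M g g"
    using assms by (simp add: dform_diff dform_diff_right nice_diff dform_sym[of g f])
  also have "\<dots> \<le> (fnorm f)\<^sup>2 + 2 * (fnorm f * fnorm g) + (fnorm g)\<^sup>2"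
    using CS[OF assms] by (simp add: fnorm_def dform_nonneg)
  also have "\<dots> = (fnorm f + fnorm g)\<^sup>2" by (simp add: power2_sum)
  finally show ?thesis
    unfolding fnorm_def[of "\<lambda>x. f x - g x"] by (intro real_le_lsqrt) (auto simp: fnorm_nonneg)
qed

lemma approx_nice: "form_approx M f u \<Longrightarrow> u k \<in> nice"
  by (simp add: form_approx_def)

lemma approx_Cauchy:
  assumes "form_approx M f u" "e > 0"
  shows "\<exists>N. \<forall>j\<ge>N. \<forall>k\<ge>N. fnorm (\<lambda>x. u j x - u k x) < e"
proof -
  have "e\<^sup>2 > 0" using assms(2) by simp
  then obtain N where "\<forall>j\<ge>N. \<forall>k\<ge>N. dform M (\<lambda>x. u j x - u k x) (\<lambda>x. u j x - u k x) < e\<^sup>2"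
    using assms(1) unfolding form_approx_def by blast
  then have "\<forall>j\<ge>N. \<forall>k\<ge>N. fnorm (\<lambda>x. u j x - u k x) < e"
    unfolding fnorm_def using assms(2) by (auto intro!: real_less_lsqrt)
  then show ?thesis by blast
qed

lemma approx_bounded:
  assumes "form_approx M f u"
  shows "\<exists>B>0. \<forall>k. fnorm (u k) \<le> B"
proof -
  obtain N where N: "\<forall>j\<ge>N. \<forall>k\<ge>N. fnorm (\<lambda>x. u j x - u k x) < 1"
    using approx_Cauchy[OF assms, of 1] by auto
  define B where "B = Max ((\<lambda>k. fnorm (u k)) ` {..N}) + 1"
  have le: "fnorm (u k) \<le> B - 1" if "k \<le> N" for k
    unfolding B_def using that by (auto intro: Max_ge)
  have tri: "fnorm (u k) \<le> fnorm (\<lambda>x. u k x - u N x) + fnorm (u N)" for k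
  proof -
    have "dform M (\<lambda>x. 0) (\<lambda>x. 0) = 0"
      using dform_diff[of "u k" "u k" "\<lambda>_. 0"] approx_nice[OF assms] nice.const by auto
    then have z: "fnorm (\<lambda>_. 0) = 0" by (simp add: fnorm_def)
    have "fnorm (\<lambda>x. 0 - u N x) \<le> fnorm (u N)"
      using fnorm_triangle[OF nice.const[of 0] approx_nice[OF assms, of N]] z by simp
    moreover have "fnorm (\<lambda>x. (u k x - u N x) - (0 - u N x)) \<le> fnorm (\<lambda>x. u k x - u N x) + fnorm (\<lambda>x. 0 - u N x)"
      by (intro fnorm_triangle nice_diff approx_nice[OF assms] nice.const)
    ultimately show ?thesis by simp
  qed
  have "fnorm (u k) \<le> B" for k
  proof (cases "k \<le> N")
    case False
    then have "fnorm (\<lambda>x. u k x - u N x) < 1" using N by auto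
    with tri[of k] le[of N] show ?thesis by simp
  qed (use le in force)
  moreover have "B > 0" using le[of 0] fnorm_nonneg[of "u 0"] by linarith
  ultimately show ?thesis by blast
qed

lemma L2_nice: "f \<in> nice \<Longrightarrow> f \<in> L2 M"
  unfolding L2_def power2_eq_square
  by (intro CollectI conjI borel_measurable_integrable bounded_integrable bounded_mult nice_bounded
      continuous_intros smooth_continuous nice_smooth)

lemma L2_diff_sq: "f \<in> L2 M \<Longrightarrow> g \<in> L2 M \<Longrightarrow> integrable M (\<lambda>x. (f x - g x)\<^sup>2)"
proof -
  assume a: "f \<in> L2 M" "g \<in> L2 M"
  show ?thesis
  proof (rule Bochner_Integration.integrable_bound)
    show "integrable M (\<lambda>x. 2 * (f x)\<^sup>2 + 2 * (g x)\<^sup>2)" using a by (auto simp: L2_def)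
    show "(\<lambda>x. (f x - g x)\<^sup>2) \<in> borel_measurable M" using a by (auto simp: L2_def)
    have "(f x - g x)\<^sup>2 \<le> 2 * (f x)\<^sup>2 + 2 * (g x)\<^sup>2" for x
      using zero_le_power2[of "f x + g x"] by (simp add: power2_sum power2_diff)
    then show "AE x in M. norm ((f x - g x)\<^sup>2) \<le> norm (2 * (f x)\<^sup>2 + 2 * (g x)\<^sup>2)" by simp
  qed
qed

lemma L2_conv_bounded:
  assumes f: "f \<in> L2 M" and u: "form_approx M f u"
    and h: "continuous_on UNIV h" "\<exists>B. \<forall>x. \<bar>h x\<bar> \<le> B"
  shows "(\<lambda>k. \<integral>x. u k x * h x \<partial>M) \<longlonglongrightarrow> (\<integral>x. f x * h x \<partial>M)"
proof -
  obtain B0 where B0: "\<forall>x. \<bar>h x\<bar> \<le> B0" using h by blast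
  define B where "B = max B0 1"
  have B: "\<bar>h x\<bar> \<le> B" "B > 0" for x using B0 by (auto simp: B_def max.coboundedI1)
  define a where "a k = (\<integral>x. (u k x - f x)\<^sup>2 \<partial>M)" for k
  have a: "a \<longlonglongrightarrow> 0" using u by (simp add: form_approx_def a_def[abs_def])
  have hm: "h \<in> borel_measurable M" using borel_measurable_integrable[OF bounded_integrable[OF h]] .
  have int: "integrable M (\<lambda>x. g x * h x)" "integrable M g" if "g \<in> L2 M" for g
  proof -
    have gm: "g \<in> borel_measurable M" using that by (simp add: L2_def)
    have i: "integrable M (\<lambda>x. B * (1 + (g x)\<^sup>2))" "integrable M (\<lambda>x. 1 + (g x)\<^sup>2)"
      using that by (auto simp: L2_def)
    have g1: "\<bar>g x\<bar> \<le> 1 + (g x)\<^sup>2" for x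
      using zero_le_power2[of "\<bar>g x\<bar> - 1"] by (simp add: power2_diff)
    have "\<bar>g x * h x\<bar> \<le> B * (1 + (g x)\<^sup>2)" for x
      using mult_mono[OF g1[of x] B(1)[of x]] by (simp add: abs_mult mult.commute)
    then show "integrable M (\<lambda>x. g x * h x)"
      using B(2) by (intro Bochner_Integration.integrable_bound[OF i(1)]) (use gm hm in auto)
    show "integrable M g"
      using g1 by (intro Bochner_Integration.integrable_bound[OF i(2)]) (use gm in auto)
  qed
  have d: "\<bar>(\<integral>x. u k x * h x \<partial>M) - (\<integral>x. f x * h x \<partial>M)\<bar> \<le> B * sqrt (a k)" for k
  proof -
    note uk = L2_nice[OF approx_nice[OF u, of k]]
    have dL2: "(\<lambda>x. u k x - f x) \<in> L2 M"
      using L2_diff_sq[OF uk f] uk f by (auto simp: L2_def)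
    have "\<bar>(\<integral>x. u k x * h x \<partial>M) - (\<integral>x. f x * h x \<partial>M)\<bar> = \<bar>\<integral>x. (u k x - f x) * h x \<partial>M\<bar>"
      using int(1)[OF uk] int(1)[OF f] by (simp add: left_diff_distrib)
    also have "\<dots> \<le> (\<integral>x. \<bar>(u k x - f x) * h x\<bar> \<partial>M)" by (rule integral_abs_bound)
    also have "\<dots> \<le> (\<integral>x. B * \<bar>u k x - f x\<bar> \<partial>M)"
      using integrable_abs[OF int(1)[OF dL2]] integrable_abs[OF int(2)[OF dL2]] B
      by (intro integral_mono) (auto simp: abs_mult mult.commute[of B] intro: mult_left_mono)
    also have "\<dots> = B * (\<integral>x. \<bar>u k x - f x\<bar> \<partial>M)" by simp
    also have "(\<integral>x. \<bar>u k x - f x\<bar> \<partial>M) \<le> sqrt (a k)"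
    proof -
      have "(\<integral>x. \<bar>u k x - f x\<bar> \<partial>M)\<^sup>2 \<le> (\<integral>x. \<bar>u k x - f x\<bar>\<^sup>2 \<partial>M)"
      proof -
        let ?X = "\<lambda>x. \<bar>u k x - f x\<bar>"
        have "0 \<le> variance ?X" by simp
        also have "variance ?X = expectation (\<lambda>x. (?X x)\<^sup>2) - (expectation ?X)\<^sup>2"
          using int(2)[OF dL2] dL2 by (intro variance_eq) (auto simp: L2_def)
        finally show ?thesis by simp
      qed
      then show ?thesis unfolding a_def by (intro real_le_rsqrt) simp
    qed
    finally show ?thesis using B(2) by simp
  qed
  have "(\<lambda>k. B * sqrt (a k)) \<longlonglongrightarrow> 0"
    using tendsto_mult_right_zero[OF tendsto_real_sqrt[OF a, simplified]] by simp
  then have "(\<lambda>k. (\<integral>x. u k x * h x \<partial>M) - (\<integral>x. f x * h x \<partial>M)) \<longlonglongrightarrow> 0"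
    by (rule Lim_null_comparison[rotated]) (use d in auto)
  then show ?thesis by (rule LIM_zero_cancel)
qed

lemma dform_limit_nice:
  assumes "f \<in> L2 M" "form_approx M f u" "g \<in> nice"
  shows "(\<lambda>k. dform M (u k) g) \<longlonglongrightarrow> - (\<integral>x. f x * diff_op V g x \<partial>M)"
  using tendsto_minus[OF L2_conv_bounded[OF assms(1,2) diff_op_bounded[OF V assms(3)]]]
    dform_by_parts[OF V ps approx_nice[OF assms(2)] assms(3)] M by simp

lemma closable:
  assumes f: "f \<in> L2 M" and u: "form_approx M f u" and v: "form_approx M f v"
  shows "(\<lambda>k. fnorm (\<lambda>x. u k x - v k x)) \<longlonglongrightarrow> 0"
proof (rule LIMSEQ_I)
  fix e :: real assume e: "e > 0"
  define w where "w k x = u k x - v k x" for k x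
  have w: "w k \<in> nice" for k unfolding w_def[abs_def] by (intro nice_diff approx_nice[OF u] approx_nice[OF v])
  obtain B C where B: "B > 0" "\<And>k. fnorm (u k) \<le> B" and C: "C > 0" "\<And>k. fnorm (v k) \<le> C"
    using approx_bounded[OF u] approx_bounded[OF v] by blast
  have wB: "fnorm (w k) \<le> B + C" for k
    using fnorm_triangle[OF approx_nice[OF u, of k] approx_nice[OF v, of k]] B(2)[of k] C(2)[of k]
    unfolding w_def[abs_def] by linarith
  define d where "d = e\<^sup>2 / (8 * (B + C))"
  have d: "d > 0" using e B C by (simp add: d_def)
  obtain N1 N2 where N: "\<forall>j\<ge>N1. \<forall>k\<ge>N1. fnorm (\<lambda>x. u j x - u k x) < d"
      "\<forall>j\<ge>N2. \<forall>k\<ge>N2. fnorm (\<lambda>x. v j x - v k x) < d"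
    using approx_Cauchy[OF u d] approx_Cauchy[OF v d] by blast
  define m where "m = max N1 N2"
  have wd: "fnorm (\<lambda>x. w k x - w m x) \<le> 2 * d" if "k \<ge> m" for k
  proof -
    have "fnorm (\<lambda>x. w k x - w m x) = fnorm (\<lambda>x. (u k x - u m x) - (v k x - v m x))"
      by (simp add: w_def algebra_simps)
    also have "\<dots> \<le> fnorm (\<lambda>x. u k x - u m x) + fnorm (\<lambda>x. v k x - v m x)"
      by (intro fnorm_triangle nice_diff approx_nice[OF u] approx_nice[OF v])
    also have "\<dots> \<le> d + d"
      using N that unfolding m_def by (intro add_mono less_imp_le) auto
    also have "\<dots> = 2 * d" by simp
    finally show ?thesis .
  qed
  have "(\<lambda>k. dform M (u k) (w m) - dform M (v k) (w m)) \<longlonglongrightarrow> 0"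
    using tendsto_diff[OF dform_limit_nice[OF f u w[of m]] dform_limit_nice[OF f v w[of m]]] by simp
  moreover have "dform M (w k) (w m) = dform M (u k) (w m) - dform M (v k) (w m)" for k
    using dform_diff[OF approx_nice[OF u, of k] approx_nice[OF v, of k] w[of m]]
    by (subst w_def[abs_def])
  ultimately have "(\<lambda>k. dform M (w k) (w m)) \<longlonglongrightarrow> 0" by presburger
  moreover have "e\<^sup>2 / 2 > 0" using e by simp
  ultimately obtain N3 where N3: "\<forall>k\<ge>N3. norm (dform M (w k) (w m) - 0) < e\<^sup>2 / 2"
    by (blast dest: LIMSEQ_D)
  have "norm (fnorm (w k) - 0) < e" if k: "k \<ge> max m N3" for k
  proof -
    have "dform M (w k) (w k) = dform M (w k) (\<lambda>x. w k x - w m x) + dform M (w k) (w m)"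
      using dform_diff_right[OF w w w, of k k m] by simp
    also have "dform M (w k) (\<lambda>x. w k x - w m x) \<le> fnorm (w k) * fnorm (\<lambda>x. w k x - w m x)"
      using CS[OF w nice_diff[OF w w], of k k m] by linarith
    also have "\<dots> \<le> (B + C) * (2 * d)"
      using wB[of k] wd[of k] k B(1) C(1) by (intro mult_mono) (auto simp: fnorm_nonneg)
    also have "\<dots> = e\<^sup>2 / 4" using B C by (simp add: d_def field_simps)
    finally have "dform M (w k) (w k) \<le> e\<^sup>2 / 4 + dform M (w k) (w m)" by simp
    moreover have "dform M (w k) (w m) < e\<^sup>2 / 2"
      using N3[rule_format, of k] k by simp
    moreover have "e\<^sup>2 / 4 + e\<^sup>2 / 2 \<le> e\<^sup>2" by simp
    ultimately have "dform M (w k) (w k) < e\<^sup>2" by linarith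
    then have "fnorm (w k) < e" unfolding fnorm_def using e by (intro real_less_lsqrt) auto
    then show ?thesis using fnorm_nonneg[of "w k"] by simp
  qed
  then show "\<exists>N. \<forall>k\<ge>N. norm (fnorm (\<lambda>x. u k x - v k x) - 0) < e"
    unfolding w_def[abs_def] by blast
qed

lemma closed_form_limit:
  assumes f: "f \<in> L2 M" and g: "g \<in> L2 M"
    and u: "form_approx M f u" and v: "form_approx M g v"
    and u': "form_approx M f u'" and v': "form_approx M g v'"
    and lim: "(\<lambda>k. dform M (u k) (v k)) \<longlonglongrightarrow> e"
  shows "(\<lambda>k. dform M (u' k) (v' k)) \<longlonglongrightarrow> e"
proof -
  obtain B C where B: "\<And>k. fnorm (v k) \<le> B" and C: "\<And>k. fnorm (u' k) \<le> C"
    using approx_bounded[OF v] approx_bounded[OF u'] by blast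
  define p where "p k = fnorm (\<lambda>x. u' k x - u k x)" for k
  define q where "q k = fnorm (\<lambda>x. v' k x - v k x)" for k
  note n = approx_nice[OF u] approx_nice[OF v] approx_nice[OF u'] approx_nice[OF v']
  have le: "\<bar>dform M (u' k) (v' k) - dform M (u k) (v k)\<bar> \<le> p k * B + C * q k" for k
  proof -
    have "dform M (u' k) (v' k) - dform M (u k) (v k) =
       dform M (\<lambda>x. u' k x - u k x) (v k) + dform M (u' k) (\<lambda>x. v' k x - v k x)"
      by (simp add: dform_diff dform_diff_right n)
    moreover have "\<bar>dform M (\<lambda>x. u' k x - u k x) (v k)\<bar> \<le> p k * fnorm (v k)"
      unfolding p_def by (intro CS nice_diff n)
    moreover have "p k * fnorm (v k) \<le> p k * B"
      unfolding p_def by (intro mult_left_mono B fnorm_nonneg)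
    moreover have "\<bar>dform M (u' k) (\<lambda>x. v' k x - v k x)\<bar> \<le> fnorm (u' k) * q k"
      unfolding q_def by (intro CS nice_diff n)
    moreover have "fnorm (u' k) * q k \<le> C * q k"
      unfolding q_def by (intro mult_right_mono C fnorm_nonneg)
    ultimately show ?thesis by linarith
  qed
  have "(\<lambda>k. p k * B + C * q k) \<longlonglongrightarrow> 0 * B + C * 0"
    unfolding p_def[abs_def] q_def[abs_def]
    by (intro tendsto_intros closable[OF f u' u] closable[OF g v' v])
  then have "(\<lambda>k. p k * B + C * q k) \<longlonglongrightarrow> 0" by simp
  then have "(\<lambda>k. dform M (u' k) (v' k) - dform M (u k) (v k)) \<longlonglongrightarrow> 0"
    by (rule Lim_null_comparison[rotated]) (simp add: le)
  from tendsto_add[OF this lim] show ?thesis by simp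
qed

lemma closed_form_eqI:
  assumes "f \<in> L2 M" "g \<in> L2 M" "form_approx M f u" "form_approx M g v"
    and "(\<lambda>k. dform M (u k) (v k)) \<longlonglongrightarrow> e"
  shows "closed_form M f g = e"
  unfolding closed_form_def
proof (rule the_equality)
  show "\<forall>u v. form_approx M f u \<longrightarrow> form_approx M g v \<longrightarrow> (\<lambda>k. dform M (u k) (v k)) \<longlonglongrightarrow> e"
    using closed_form_limit[OF assms(1-4) _ _ assms(5)] by blast
next
  fix e' assume "\<forall>u v. form_approx M f u \<longrightarrow> form_approx M g v \<longrightarrow> (\<lambda>k. dform M (u k) (v k)) \<longlonglongrightarrow> e'"
  then have "(\<lambda>k. dform M (u k) (v k)) \<longlonglongrightarrow> e'" using assms(3,4) by simp
  then show "e' = e" using assms(5) by (rule LIMSEQ_unique)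
qed

lemma approx_self: "f \<in> nice \<Longrightarrow> form_approx M f (\<lambda>_. f)"
  using dform_diff[OF _ _ nice.const[of 0], of f f] by (simp add: form_approx_def)

lemma form_dom_dform_convergent:
  assumes u: "form_approx M f u" and v: "form_approx M g v"
  shows "convergent (\<lambda>k. dform M (u k) (v k))"
proof -
  obtain B C where B: "B > 0" "\<And>k. fnorm (v k) \<le> B" and C: "C > 0" "\<And>k. fnorm (u k) \<le> C"
    using approx_bounded[OF v] approx_bounded[OF u] by blast
  note n = approx_nice[OF u] approx_nice[OF v]
  have "Cauchy (\<lambda>k. dform M (u k) (v k))"
  proof (rule CauchyI)
    fix e :: real assume e: "e > 0"
    define d where "d = e / (B + C)"
    have d: "d > 0" using e B C by (simp add: d_def)
    obtain N1 N2 where N: "\<forall>j\<ge>N1. \<forall>k\<ge>N1. fnorm (\<lambda>x. u j x - u k x) < d"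
        "\<forall>j\<ge>N2. \<forall>k\<ge>N2. fnorm (\<lambda>x. v j x - v k x) < d"
      using approx_Cauchy[OF u d] approx_Cauchy[OF v d] by blast
    have "norm (dform M (u j) (v j) - dform M (u k) (v k)) < e"
      if "j \<ge> max N1 N2" "k \<ge> max N1 N2" for j k
    proof -
      have "dform M (u j) (v j) - dform M (u k) (v k) =
         dform M (\<lambda>x. u j x - u k x) (v j) + dform M (u k) (\<lambda>x. v j x - v k x)"
        by (simp add: dform_diff dform_diff_right n)
      moreover have "\<bar>dform M (\<lambda>x. u j x - u k x) (v j)\<bar> \<le> fnorm (\<lambda>x. u j x - u k x) * fnorm (v j)"
        by (intro CS nice_diff n)
      moreover have "fnorm (\<lambda>x. u j x - u k x) * fnorm (v j) \<le> fnorm (\<lambda>x. u j x - u k x) * B"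
        by (intro mult_left_mono B fnorm_nonneg)
      moreover have "fnorm (\<lambda>x. u j x - u k x) * B < d * B"
        using N that B by (intro mult_strict_right_mono) auto
      moreover have "\<bar>dform M (u k) (\<lambda>x. v j x - v k x)\<bar> \<le> fnorm (u k) * fnorm (\<lambda>x. v j x - v k x)"
        by (intro CS nice_diff n)
      moreover have "fnorm (u k) * fnorm (\<lambda>x. v j x - v k x) \<le> C * fnorm (\<lambda>x. v j x - v k x)"
        by (intro mult_right_mono C fnorm_nonneg)
      moreover have "C * fnorm (\<lambda>x. v j x - v k x) < C * d"
        using N that C by (intro mult_strict_left_mono) auto
      moreover have "d * B + C * d = d * (B + C)" by (simp add: algebra_simps)
      moreover have "d * (B + C) = e" using B C by (simp add: d_def)
      ultimately show ?thesis unfolding real_norm_def by linarith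
    qed
    then show "\<exists>N. \<forall>m\<ge>N. \<forall>n\<ge>N. norm (dform M (u m) (v m) - dform M (u n) (v n)) < e" by blast
  qed
  then show ?thesis by (simp add: Cauchy_convergent_iff)
qed

lemma closed_form_tendsto:
  assumes "f \<in> L2 M" "g \<in> L2 M" "form_approx M f u" "form_approx M g v"
  shows "(\<lambda>k. dform M (u k) (v k)) \<longlonglongrightarrow> closed_form M f g"
proof -
  obtain e where "(\<lambda>k. dform M (u k) (v k)) \<longlonglongrightarrow> e"
    using form_dom_dform_convergent[OF assms(3,4)] convergentD by blast
  with closed_form_eqI[OF assms this] show ?thesis by simp
qed

lemma closed_form_nice: "f \<in> nice \<Longrightarrow> g \<in> nice \<Longrightarrow> closed_form M f g = dform M f g"
  by (rule closed_form_eqI[OF L2_nice L2_nice approx_self approx_self]) auto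

lemma generator_nice:
  assumes "f \<in> nice"
  shows "(f, diff_op V f) \<in> generator M"
  unfolding generator_def
proof (clarify, intro conjI ballI)
  show "f \<in> form_dom M" using assms L2_nice approx_self by (auto simp: form_dom_def)
  show "diff_op V f \<in> L2 M"
    unfolding L2_def power2_eq_square
    by (intro CollectI conjI borel_measurable_integrable bounded_integrable bounded_mult
        diff_op_bounded V assms continuous_intros)
  fix g assume "g \<in> form_dom M"
  then obtain v where g: "g \<in> L2 M" "form_approx M g v" by (auto simp: form_dom_def)
  have "(\<lambda>k. dform M f (v k)) \<longlonglongrightarrow> - (\<integral>x. diff_op V f x * g x \<partial>M)"
    using dform_limit_nice[OF g assms] by (simp add: dform_sym mult.commute)
  then show "closed_form M f g = - (\<integral>x. diff_op V f x * g x \<partial>M)"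
    by (intro closed_form_eqI[OF L2_nice g(1) approx_self g(2)] assms)
qed

end

end

theory Submission
  imports Defs
begin

text \<open>
  Integrating by parts against \<open>f\<^sup>2 / W\<close> and completing the square gives
  \<open>\<integral> (- L W / W) f\<^sup>2 d\<mu> \<le> \<integral> |\<nabla>f|\<^sup>2 d\<mu>\<close>. The Lyapunov condition bounds \<open>\<lambda> f\<^sup>2\<close> by
  \<open>(- L W / W) f\<^sup>2 + b 1\<^sub>B f\<^sup>2\<close> with \<open>B\<close> the ball, and applying this to \<open>f\<close> minus its mean over
  \<open>B\<close> makes the local Poincare inequality control the last term.

  Since \<open>W\<close> is only in the domain of the generator, \<open>f\<^sup>2 / W\<close> is replaced by \<open>f\<^sup>2 / w\<^sub>k\<close>, where
  \<open>w\<^sub>k = 1 + sqrt ((u\<^sub>k - 1)\<^sup>2 + \<epsilon>\<^sub>k\<^sup>2)\<close> for nice functions \<open>u\<^sub>k\<close> converging to \<open>W\<close> in the form norm.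
  The \<open>w\<^sub>k\<close> are nice, at least \<open>1\<close>, and still converge to \<open>1 + |W - 1| = W\<close> in the form norm.
\<close>

section \<open>Nice functions under inverse and square root\<close>

lemma Ck_inverse:
  assumes "\<And>x. f x \<noteq> 0" "Ck k f"
  shows "Ck k (\<lambda>x. inverse (f x))"
  using assms(2)
proof (induction k)
  case 0
  then show ?case using assms(1) by (auto intro: continuous_intros)
next
  case (Suc k)
  have d: "((\<lambda>x. inverse (f x)) has_derivative
      (\<lambda>v. - (inverse (f x) * frechet_derivative f (at x) v * inverse (f x)))) (at x)" for x
    by (rule Deriv.has_derivative_inverse)
       (use Suc.prems assms(1) in \<open>auto simp: frechet_derivative_works[symmetric]\<close>)
  \<comment> \<open>Writing the sign as a constant factor \<open>-1\<close> makes the derivative a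
    product to which \<open>Ck_mult\<close> and \<open>Ck_const\<close> apply; the induction
    hypothesis covers the two factors \<open>inverse (f x)\<close>.\<close>
  have "frechet_derivative (\<lambda>x. inverse (f x)) (at x) v =
      (-1) * (inverse (f x) * frechet_derivative f (at x) v * inverse (f x))" for x v
    using fun_cong[OF frechet_derivative_at[OF d[of x]], of v] by simp
  moreover have "Ck k (\<lambda>x. inverse (f x))" using Suc Ck_Suc_imp by blast
  ultimately have "Ck k (\<lambda>x. frechet_derivative (\<lambda>x. inverse (f x)) (at x) v)" for v
    using Suc.prems by (simp only: Ck.simps Ck_mult Ck_const)
  then show ?case using d by (auto intro: differentiableI)
qed

text \<open>The derivative \<open>f' / (2 sqrt f)\<close> contains the inverse of the square root
  itself, so the induction step feeds the induction hypothesis into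
  \<open>Ck_inverse\<close>.\<close>

lemma Ck_sqrt:
  assumes "\<And>x. f x > 0" "Ck k f"
  shows "Ck k (\<lambda>x. sqrt (f x))"
  using assms(2)
proof (induction k)
  case 0
  then show ?case by (auto intro: continuous_intros)
next
  case (Suc k)
  have d: "((\<lambda>x. sqrt (f x)) has_derivative
      (\<lambda>v. frechet_derivative f (at x) v * (inverse (sqrt (f x)) / 2))) (at x)" for x
    using Suc.prems assms(1) by (intro has_derivative_real_sqrt) (auto simp: frechet_derivative_works)
  have "frechet_derivative (\<lambda>x. sqrt (f x)) (at x) v =
      frechet_derivative f (at x) v * (inverse (sqrt (f x)) * (1 / 2))" for x v
    using fun_cong[OF frechet_derivative_at[OF d[of x]], of v] by simp
  moreover have "Ck k (\<lambda>x. inverse (sqrt (f x)))"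
    using Suc Ck_Suc_imp assms(1) by (intro Ck_inverse) (auto simp: less_imp_neq[symmetric])
  ultimately have "Ck k (\<lambda>x. frechet_derivative (\<lambda>x. sqrt (f x)) (at x) v)" for v
    using Suc.prems by (simp only: Ck.simps Ck_mult Ck_const)
  then show ?case using d by (auto intro: differentiableI)
qed

lemma smooth_add_const: "smooth f \<Longrightarrow> smooth (\<lambda>x. f x + c)"
  by (simp add: smooth_def Ck_add Ck_const)

text \<open>Subtracting the constant leaves a test function. With \<open>nice_smooth\<close> and
  \<open>nice_const_outside\<close> this identifies \<open>nice\<close> as the smooth functions that
  are constant off a compact set, which opens the algebra to operations other than sums and
  products.\<close>

lemma nice_of_smooth:
  assumes "smooth f" "compact S" "\<And>x. x \<notin> S \<Longrightarrow> f x = c"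
  shows "f \<in> nice"
proof -
  have "{x. f x + - c \<noteq> 0} \<subseteq> S" using assms(3) by force
  then have "bounded {x. f x + - c \<noteq> 0}"
    using assms(2) compact_imp_bounded bounded_subset by blast
  then have "(\<lambda>x. f x + - c) \<in> test_functions"
    using assms(1) by (simp add: test_functions_def smooth_add_const compact_closure del: add_uminus_conv_diff)
  from nice.add[OF nice.test[OF this] nice.const[of c]] show ?thesis by simp
qed

lemma nice_inverse:
  assumes "f \<in> nice" "\<And>x. f x \<noteq> 0"
  shows "(\<lambda>x. inverse (f x)) \<in> nice"
proof -
  obtain c S where "compact S" "\<forall>x. x \<notin> S \<longrightarrow> f x = c"
    using nice_const_outside[OF assms(1)] by blast
  moreover have "smooth (\<lambda>x. inverse (f x))"
    using nice_smooth[OF assms(1)] Ck_inverse[of f, OF assms(2)] by (simp add: smooth_def)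
  ultimately show ?thesis by (intro nice_of_smooth[of _ S "inverse c"]) auto
qed

lemma nice_sqrt:
  assumes "f \<in> nice" "\<And>x. f x > 0"
  shows "(\<lambda>x. sqrt (f x)) \<in> nice"
proof -
  obtain c S where "compact S" "\<forall>x. x \<notin> S \<longrightarrow> f x = c"
    using nice_const_outside[OF assms(1)] by blast
  moreover have "smooth (\<lambda>x. sqrt (f x))"
    using nice_smooth[OF assms(1)] Ck_sqrt[of f, OF assms(2)] by (simp add: smooth_def)
  ultimately show ?thesis by (intro nice_of_smooth[of _ S "sqrt c"]) auto
qed

section \<open>Chain rule, regularisation, and the gradient of a quotient\<close>

lemma grad_chain:
  assumes "f differentiable (at x)" "(\<phi> has_real_derivative d) (at (f x))"
  shows "grad (\<lambda>x. \<phi> (f x)) x = d *\<^sub>R grad f x"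
proof -
  have "((\<lambda>x. \<phi> (f x)) has_derivative (\<lambda>v. d * frechet_derivative f (at x) v)) (at x)"
    using assms unfolding has_field_derivative_def frechet_derivative_works
    by (auto intro: has_derivative_compose)
  from frechet_derivative_at[OF this, symmetric]
  show ?thesis by (simp add: grad_def partial_def vec_eq_iff)
qed

lemma grad_mult:
  assumes "f differentiable (at x)" "g differentiable (at x)"
  shows "grad (\<lambda>x. f x * g x) x = f x *\<^sub>R grad g x + g x *\<^sub>R grad f x"
  using partial_mult[OF assms] by (simp add: grad_def vec_eq_iff mult.commute)

text \<open>A smoothing of \<open>1 + |t - 1|\<close>. That map fixes every \<open>t >= 1\<close>
  and is 1-Lipschitz; for \<open>e\<close> nonzero the argument of the root stays positive, so
  smoothness survives.\<close>

definition reg :: "real \<Rightarrow> real \<Rightarrow> real" where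
  "reg e t = 1 + sqrt ((t - 1)\<^sup>2 + e\<^sup>2)"

lemma reg_ge_1: "reg e t \<ge> 1"
  by (simp add: reg_def)

text \<open>For \<open>s >= 1\<close> one has \<open>s = 1 + |s - 1|\<close>, so the reverse
  triangle inequality gives \<open>|t - s|\<close>, and the smoothing adds at most
  \<open>e\<close>.\<close>

lemma reg_dist:
  assumes "e \<ge> 0" "s \<ge> 1"
  shows "\<bar>reg e t - s\<bar> \<le> \<bar>t - s\<bar> + e"
proof -
  have "sqrt ((t - 1)\<^sup>2 + e\<^sup>2) \<le> \<bar>t - 1\<bar> + e"
    using sqrt_sum_squares_le_sum_abs[of "t - 1" e] assms by simp
  moreover have "\<bar>t - 1\<bar> \<le> sqrt ((t - 1)\<^sup>2 + e\<^sup>2)"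
    using real_sqrt_sum_squares_ge1[of "\<bar>t - 1\<bar>" e] by simp
  ultimately show ?thesis unfolding reg_def using assms by linarith
qed

lemma nice_reg:
  assumes "u \<in> nice" "e \<noteq> 0"
  shows "(\<lambda>x. reg e (u x)) \<in> nice"
  unfolding reg_def power2_eq_square using assms
  by (intro nice.add nice.const nice_sqrt nice.mult nice_diff)
     (auto simp: sum_power2_gt_zero_iff power2_eq_square[symmetric])

lemma reg_deriv:
  assumes "e \<noteq> 0"
  shows "\<exists>d. \<bar>d\<bar> \<le> 1 \<and> (reg e has_real_derivative d) (at t)"
proof -
  have pos: "(t - 1)\<^sup>2 + e\<^sup>2 > 0" using assms by (simp add: sum_power2_gt_zero_iff)
  have "(reg e has_real_derivative (t - 1) / sqrt ((t - 1)\<^sup>2 + e\<^sup>2)) (at t)"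
    unfolding reg_def[abs_def] using pos
    by (auto intro!: derivative_eq_intros simp: divide_simps)
  moreover have "\<bar>(t - 1) / sqrt ((t - 1)\<^sup>2 + e\<^sup>2)\<bar> \<le> 1"
    using pos real_sqrt_sum_squares_ge1[of "\<bar>t - 1\<bar>" e] by (simp add: abs_div)
  ultimately show ?thesis by blast
qed

text \<open>The chain rule multiplies the gradient by a slope of absolute value at most 1. This
  gives the energy comparison demanded by \<open>form_approx_contraction\<close>.\<close>

lemma norm_grad_reg:
  assumes "u \<in> nice" "e \<noteq> 0"
  shows "(norm (grad (\<lambda>x. reg e (u x)) x))\<^sup>2 \<le> (norm (grad u x))\<^sup>2"
proof -
  obtain d where d: "\<bar>d\<bar> \<le> 1" "(reg e has_real_derivative d) (at (u x))"
    using reg_deriv[OF assms(2)] by blast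
  have "norm (grad (\<lambda>x. reg e (u x)) x) = \<bar>d\<bar> * norm (grad u x)"
    using grad_chain[OF smooth_differentiable[OF nice_smooth[OF assms(1)]] d(2)] by simp
  also have "\<dots> \<le> norm (grad u x)" using d(1) by (simp add: mult_left_le_one_le)
  finally show ?thesis by (simp add: power_mono)
qed

text \<open>Grouping by powers of \<open>f / w\<close> prepares two uses: the inner product with
  \<open>grad w\<close> completes to a square, and both coefficients stay bounded when
  \<open>f\<close> is bounded and \<open>w >= 1\<close>.\<close>

lemma grad_quotient:
  assumes "f \<in> nice" "w \<in> nice" "\<And>x. w x \<noteq> 0"
  shows "grad (\<lambda>x. (f x)\<^sup>2 * inverse (w x)) x =
    (2 * f x / w x) *\<^sub>R grad f x - (f x / w x)\<^sup>2 *\<^sub>R grad w x"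
proof -
  have df: "f differentiable (at x)" and dw: "w differentiable (at x)"
    using assms nice_smooth smooth_differentiable by blast+
  have 1: "grad (\<lambda>x. (f x)\<^sup>2) x = (2 * f x) *\<^sub>R grad f x"
    by (rule grad_chain[OF df]) (auto intro!: derivative_eq_intros)
  have 2: "grad (\<lambda>x. inverse (w x)) x = (- inverse (w x) * inverse (w x)) *\<^sub>R grad w x"
    by (rule grad_chain[OF dw]) (use assms(3) in \<open>auto intro!: derivative_eq_intros simp: power2_eq_square\<close>)
  have "grad (\<lambda>x. (f x)\<^sup>2 * inverse (w x)) x =
      (f x)\<^sup>2 *\<^sub>R grad (\<lambda>x. inverse (w x)) x + inverse (w x) *\<^sub>R grad (\<lambda>x. (f x)\<^sup>2) x"
    using df dw assms(3) by (intro grad_mult differentiable_power differentiable_inverse) auto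
  then show ?thesis unfolding 1 2 by (simp add: divide_inverse power2_eq_square mult_ac)
qed

section \<open>Square-integrable functions under the Gibbs measure\<close>

context
  fixes V :: "real ^ 'n \<Rightarrow> real" and Z :: real and M
  assumes V: "smooth V" and ps: "prob_space (gibbs Z V)" and M: "M = gibbs Z V"
begin

interpretation prob_space M using ps M by simp

private lemmas fnorm_def = fnorm_def[OF V ps M] and fnorm_nonneg = fnorm_nonneg[OF V ps M]
  and CS = CS[OF V ps M] and fnorm_triangle = fnorm_triangle[OF V ps M]
  and approx_nice = approx_nice[OF V ps M] and approx_Cauchy = approx_Cauchy[OF V ps M]
  and approx_bounded = approx_bounded[OF V ps M] and approx_self = approx_self[OF V ps M]
  and L2_nice = L2_nice[OF V ps M] and L2_diff_sq = L2_diff_sq[OF V ps M]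
  and integrable_grad = integrable_grad[OF V ps M]
  and dform_nonneg = dform_nonneg[OF V ps M] and dform_sym = dform_sym[OF V ps M]
  and dform_diff = dform_diff[OF V ps M] and dform_diff_right = dform_diff_right[OF V ps M]
  and closed_form_tendsto = closed_form_tendsto[OF V ps M]
  and generator_nice = generator_nice[OF V ps M]

lemma L2_mult_integrable:
  assumes "f \<in> L2 M" "g \<in> L2 M"
  shows "integrable M (\<lambda>x. f x * g x)"
proof (rule Bochner_Integration.integrable_bound)
  show "integrable M (\<lambda>x. (f x)\<^sup>2 + (g x)\<^sup>2)" using assms by (auto simp: L2_def)
  show "(\<lambda>x. f x * g x) \<in> borel_measurable M" using assms by (auto simp: L2_def)
  have "\<bar>f x * g x\<bar> \<le> (f x)\<^sup>2 + (g x)\<^sup>2" for x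
    using sum_squares_bound[of "\<bar>f x\<bar>" "\<bar>g x\<bar>"] mult_nonneg_nonneg[of "\<bar>f x\<bar>" "\<bar>g x\<bar>"]
    unfolding abs_mult power2_abs by linarith
  then show "AE x in M. norm (f x * g x) \<le> norm ((f x)\<^sup>2 + (g x)\<^sup>2)" by simp
qed

text \<open>The inequality is taken for nonnegative integrals, where integrability is not an issue;
  integrability of \<open>|f g|\<close> and of the squares turns each of them back into a real
  integral.\<close>

lemma L2_Cauchy_Schwarz:
  assumes "f \<in> L2 M" "g \<in> L2 M"
  shows "\<bar>\<integral>x. f x * g x \<partial>M\<bar> \<le> sqrt (\<integral>x. (f x)\<^sup>2 \<partial>M) * sqrt (\<integral>x. (g x)\<^sup>2 \<partial>M)"
proof -
  have m[measurable]: "f \<in> borel_measurable M" "g \<in> borel_measurable M"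
    and i: "integrable M (\<lambda>x. (f x)\<^sup>2)" "integrable M (\<lambda>x. (g x)\<^sup>2)"
    using assms by (auto simp: L2_def)
  have ifg: "integrable M (\<lambda>x. \<bar>f x * g x\<bar>)"
    using L2_mult_integrable[OF assms] by (rule integrable_abs)
  have "(\<integral>\<^sup>+x. ennreal \<bar>f x\<bar> * ennreal \<bar>g x\<bar> \<partial>M)\<^sup>2 \<le>
      (\<integral>\<^sup>+x. (ennreal \<bar>f x\<bar>)\<^sup>2 \<partial>M) * (\<integral>\<^sup>+x. (ennreal \<bar>g x\<bar>)\<^sup>2 \<partial>M)"
    by (rule Cauchy_Schwarz_nn_integral) measurable
  also have "(\<integral>\<^sup>+x. ennreal \<bar>f x\<bar> * ennreal \<bar>g x\<bar> \<partial>M) = ennreal (\<integral>x. \<bar>f x * g x\<bar> \<partial>M)"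
    using nn_integral_eq_integral[OF ifg] by (simp add: ennreal_mult' abs_mult)
  also have "(\<integral>\<^sup>+x. (ennreal \<bar>f x\<bar>)\<^sup>2 \<partial>M) = ennreal (\<integral>x. (f x)\<^sup>2 \<partial>M)"
    using nn_integral_eq_integral[OF i(1)] by (simp add: ennreal_power)
  also have "(\<integral>\<^sup>+x. (ennreal \<bar>g x\<bar>)\<^sup>2 \<partial>M) = ennreal (\<integral>x. (g x)\<^sup>2 \<partial>M)"
    using nn_integral_eq_integral[OF i(2)] by (simp add: ennreal_power)
  finally have "(\<integral>x. \<bar>f x * g x\<bar> \<partial>M)\<^sup>2 \<le> (\<integral>x. (f x)\<^sup>2 \<partial>M) * (\<integral>x. (g x)\<^sup>2 \<partial>M)"
    by (simp add: ennreal_power ennreal_mult'[symmetric] ennreal_le_iff)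
  then have "(\<integral>x. \<bar>f x * g x\<bar> \<partial>M) \<le> sqrt (\<integral>x. (f x)\<^sup>2 \<partial>M) * sqrt (\<integral>x. (g x)\<^sup>2 \<partial>M)"
    unfolding real_sqrt_mult[symmetric] by (rule real_le_rsqrt)
  then show ?thesis using integral_abs_bound[of M "\<lambda>x. f x * g x"] by linarith
qed

section \<open>Convergence in the form norm\<close>

lemma L2_mult_tendsto_0:
  assumes "h \<in> L2 M" "\<And>k. v k \<in> L2 M" "(\<lambda>k. \<integral>x. (v k x)\<^sup>2 \<partial>M) \<longlonglongrightarrow> 0"
  shows "(\<lambda>k. \<integral>x. h x * v k x \<partial>M) \<longlonglongrightarrow> 0"
proof (rule Lim_null_comparison)
  show "\<forall>\<^sub>F k in sequentially. norm (\<integral>x. h x * v k x \<partial>M) \<le>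
      sqrt (\<integral>x. (h x)\<^sup>2 \<partial>M) * sqrt (\<integral>x. (v k x)\<^sup>2 \<partial>M)"
    using L2_Cauchy_Schwarz[OF assms(1,2)] by simp
  show "(\<lambda>k. sqrt (\<integral>x. (h x)\<^sup>2 \<partial>M) * sqrt (\<integral>x. (v k x)\<^sup>2 \<partial>M)) \<longlonglongrightarrow> 0"
    using tendsto_mult_right_zero[OF tendsto_real_sqrt[OF assms(3), simplified]] by simp
qed

text \<open>Integration by parts moves all derivatives onto the fixed \<open>g\<close>, and
  \<open>diff_op V g\<close> is in \<open>L2 M\<close>. Hence convergence of \<open>v k\<close> in
  mean square suffices, without control of its gradients.\<close>

lemma dform_tendsto_0:
  assumes "\<And>k. v k \<in> nice" "(\<lambda>k. \<integral>x. (v k x)\<^sup>2 \<partial>M) \<longlonglongrightarrow> 0" "g \<in> nice"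
  shows "(\<lambda>k. dform M (v k) g) \<longlonglongrightarrow> 0"
proof -
  have "diff_op V g \<in> L2 M" using generator_nice[OF assms(3)] by (simp add: generator_def)
  from tendsto_minus[OF L2_mult_tendsto_0[OF this L2_nice[OF assms(1)] assms(2)]] show ?thesis
    using dform_by_parts[OF V ps assms(1,3)] by (simp add: M mult.commute)
qed

text \<open>Contractions of an approximating sequence converge weakly in the form norm, by
  integration by parts, and do not increase the norm; in a Hilbert space this forces strong
  convergence.\<close>

lemma form_approx_contraction:
  assumes W: "W \<in> L2 M" and u: "form_approx M W u" and w: "\<And>k. w k \<in> nice"
    and le: "\<And>k. dform M (w k) (w k) \<le> dform M (u k) (u k)"
    and lim: "(\<lambda>k. \<integral>x. (w k x - W x)\<^sup>2 \<partial>M) \<longlonglongrightarrow> 0"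
  shows "form_approx M W w"
proof -
  note un = approx_nice[OF u]
  define d where "d k x = w k x - u k x" for k x
  have dn: "d k \<in> nice" for k unfolding d_def[abs_def] by (intro nice_diff w un)
  have ulim: "(\<lambda>k. \<integral>x. (u k x - W x)\<^sup>2 \<partial>M) \<longlonglongrightarrow> 0" using u by (simp add: form_approx_def)
  have dlim: "(\<lambda>k. \<integral>x. (d k x)\<^sup>2 \<partial>M) \<longlonglongrightarrow> 0"
  proof (rule Lim_null_comparison)
    have "(\<integral>x. (d k x)\<^sup>2 \<partial>M) \<le> (\<integral>x. 2 * (w k x - W x)\<^sup>2 + 2 * (u k x - W x)\<^sup>2 \<partial>M)" for k
    proof (rule integral_mono)
      show "integrable M (\<lambda>x. (d k x)\<^sup>2)" using L2_nice[OF dn] by (simp add: L2_def)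
      show "integrable M (\<lambda>x. 2 * (w k x - W x)\<^sup>2 + 2 * (u k x - W x)\<^sup>2)"
        using L2_diff_sq[OF L2_nice[OF w] W] L2_diff_sq[OF L2_nice[OF un] W] by simp
      show "(d k x)\<^sup>2 \<le> 2 * (w k x - W x)\<^sup>2 + 2 * (u k x - W x)\<^sup>2" for x
        using zero_le_power2[of "(w k x - W x) + (u k x - W x)"]
        unfolding d_def power2_eq_square by (simp add: algebra_simps)
    qed
    also have "(\<integral>x. 2 * (w k x - W x)\<^sup>2 + 2 * (u k x - W x)\<^sup>2 \<partial>M) =
        2 * (\<integral>x. (w k x - W x)\<^sup>2 \<partial>M) + 2 * (\<integral>x. (u k x - W x)\<^sup>2 \<partial>M)" for k
      using L2_diff_sq[OF L2_nice[OF w] W] L2_diff_sq[OF L2_nice[OF un] W] by simp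
    finally show "\<forall>\<^sub>F k in sequentially. norm (\<integral>x. (d k x)\<^sup>2 \<partial>M) \<le>
        2 * (\<integral>x. (w k x - W x)\<^sup>2 \<partial>M) + 2 * (\<integral>x. (u k x - W x)\<^sup>2 \<partial>M)" by simp
    show "(\<lambda>k. 2 * (\<integral>x. (w k x - W x)\<^sup>2 \<partial>M) + 2 * (\<integral>x. (u k x - W x)\<^sup>2 \<partial>M)) \<longlonglongrightarrow> 0"
      using tendsto_add[OF tendsto_mult_right_zero[OF lim] tendsto_mult_right_zero[OF ulim]] by simp
  qed
  obtain B where B: "B > 0" "\<And>k. fnorm M (u k) \<le> B" using approx_bounded[OF u] by blast
  have dB: "fnorm M (d k) \<le> 2 * B" for k
  proof -
    have "fnorm M (w k) \<le> fnorm M (u k)" using le by (simp add: fnorm_def)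
    then show ?thesis using fnorm_triangle[OF w un, of k k] B(2)[of k] by (simp add: d_def[abs_def])
  qed
  have small: "\<exists>N. \<forall>k\<ge>N. fnorm M (d k) < e" if e: "e > 0" for e
  proof -
    \<comment> \<open>Chosen so that \<open>r * (2 * B) = e\<^sup>2 / 4\<close>. Together with the
      bound \<open>e\<^sup>2 / 8\<close> below, the energy of \<open>d k\<close> is then less than
      \<open>2 * (e\<^sup>2 / 8 + e\<^sup>2 / 4)\<close>, which is below
      \<open>e\<^sup>2\<close>.\<close>
    define r where "r = e\<^sup>2 / (8 * B)"
    have r: "r > 0" using e B(1) by (simp add: r_def)
    \<comment> \<open>The index \<open>m\<close> is frozen because weak convergence of
      \<open>d k\<close> is available only against a fixed nice function; the Cauchy property pays
      for replacing \<open>u k\<close> by \<open>u m\<close>.\<close>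
    obtain m where m: "\<forall>j\<ge>m. \<forall>k\<ge>m. fnorm M (\<lambda>x. u j x - u k x) < r"
      using approx_Cauchy[OF u r] by blast
    have "e\<^sup>2 / 8 > 0" using e by simp
    then obtain N where N: "\<forall>k\<ge>N. norm (dform M (d k) (u m) - 0) < e\<^sup>2 / 8"
      using LIMSEQ_D[OF dform_tendsto_0[OF dn dlim un[of m]]] by blast
    have "fnorm M (d k) < e" if k: "k \<ge> max m N" for k
    proof -
      \<comment> \<open>Expansion of the energy of \<open>w k = u k + d k\<close>. As the right side
        is at most 0, the energy of \<open>d k\<close> is controlled by its inner product with
        \<open>u k\<close>.\<close>
      have "dform M (d k) (d k) + 2 * dform M (u k) (d k) = dform M (w k) (w k) - dform M (u k) (u k)"
        by (simp add: d_def[abs_def] dform_diff dform_diff_right nice_diff w un dform_sym[of "w k" "u k"])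
      then have "dform M (d k) (d k) \<le> - 2 * dform M (u k) (d k)" using le[of k] by linarith
      moreover have "dform M (u k) (d k) = dform M (d k) (u m) + dform M (\<lambda>x. u k x - u m x) (d k)"
        by (simp add: dform_diff dn un dform_sym[of "d k" "u m"])
      moreover have "\<bar>dform M (\<lambda>x. u k x - u m x) (d k)\<bar> \<le> r * (2 * B)"
      proof -
        have "\<bar>dform M (\<lambda>x. u k x - u m x) (d k)\<bar> \<le> fnorm M (\<lambda>x. u k x - u m x) * fnorm M (d k)"
          by (intro CS nice_diff un dn)
        also have "\<dots> \<le> r * (2 * B)"
          using m k r dB[of k] by (intro mult_mono) (auto simp: fnorm_nonneg less_imp_le)
        finally show ?thesis .
      qed
      moreover have "r * (2 * B) = e\<^sup>2 / 4" using B(1) by (simp add: r_def)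
      moreover have "\<bar>dform M (d k) (u m)\<bar> < e\<^sup>2 / 8" using N k by simp
      moreover have "e\<^sup>2 > 0" using e by simp
      ultimately have "dform M (d k) (d k) < e\<^sup>2" by linarith
      then show ?thesis unfolding fnorm_def using e by (intro real_less_lsqrt) auto
    qed
    then show ?thesis by blast
  qed
  have "\<exists>N. \<forall>j\<ge>N. \<forall>k\<ge>N. dform M (\<lambda>x. w j x - w k x) (\<lambda>x. w j x - w k x) < e" if e: "e > 0" for e
  proof -
    have r: "sqrt e / 3 > 0" using e by simp
    obtain N1 N2 where N: "\<forall>k\<ge>N1. fnorm M (d k) < sqrt e / 3"
        "\<forall>j\<ge>N2. \<forall>k\<ge>N2. fnorm M (\<lambda>x. u j x - u k x) < sqrt e / 3"
      using small[OF r] approx_Cauchy[OF u r] by blast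
    have "dform M (\<lambda>x. w j x - w k x) (\<lambda>x. w j x - w k x) < e"
      if "j \<ge> max N1 N2" "k \<ge> max N1 N2" for j k
    proof -
      \<comment> \<open>Arranged as a difference of differences to match
        \<open>fnorm_triangle\<close>; the three resulting norms are each below
        \<open>sqrt e / 3\<close>.\<close>
      have "fnorm M (\<lambda>x. w j x - w k x) = fnorm M (\<lambda>x. (d j x - d k x) - (u k x - u j x))"
        by (simp add: d_def algebra_simps)
      also have "\<dots> \<le> fnorm M (\<lambda>x. d j x - d k x) + fnorm M (\<lambda>x. u k x - u j x)"
        by (intro fnorm_triangle nice_diff dn un)
      also have "fnorm M (\<lambda>x. d j x - d k x) \<le> fnorm M (d j) + fnorm M (d k)"
        by (intro fnorm_triangle dn)
      finally have "fnorm M (\<lambda>x. w j x - w k x) < sqrt e"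
        using N(1)[rule_format, of j] N(1)[rule_format, of k] N(2)[rule_format, of k j] that by simp
      then show ?thesis by (simp add: fnorm_def)
    qed
    then show ?thesis by blast
  qed
  then show ?thesis using w lim by (simp add: form_approx_def)
qed

lemma form_approx_ge_1:
  assumes "W \<in> form_dom M" "AE x in M. W x \<ge> 1"
  obtains w where "form_approx M W w" "\<And>k x. w k x \<ge> 1"
proof -
  obtain u where W: "W \<in> L2 M" and u: "form_approx M W u"
    using assms(1) by (auto simp: form_dom_def)
  note un = approx_nice[OF u]
  \<comment> \<open>Positive, so that each \<open>w k\<close> is nice, and tending to 0, so that the
    smoothing error vanishes in mean square.\<close>
  define e where "e k = inverse (real (Suc k))" for k
  have e: "e k > 0" for k by (simp add: e_def)
  have elim: "e \<longlonglongrightarrow> 0" unfolding e_def[abs_def] by (rule LIMSEQ_inverse_real_of_nat)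
  define w where "w k x = reg (e k) (u k x)" for k x
  have w: "w k \<in> nice" for k
    unfolding w_def[abs_def] using e[of k] by (intro nice_reg un) simp
  have "form_approx M W w"
  proof (rule form_approx_contraction[OF W u w])
    show "dform M (w k) (w k) \<le> dform M (u k) (u k)" for k
      unfolding dform_def
    proof (rule integral_mono[OF integrable_grad[OF w w] integrable_grad[OF un un]])
      show "grad (w k) x \<bullet> grad (w k) x \<le> grad (u k) x \<bullet> grad (u k) x" for x
        using norm_grad_reg[OF un, of "e k" k x] e[of k] by (simp add: w_def[abs_def] power2_norm_eq_inner)
    qed
    show "(\<lambda>k. \<integral>x. (w k x - W x)\<^sup>2 \<partial>M) \<longlonglongrightarrow> 0"
    proof (rule Lim_null_comparison)
      have "(\<integral>x. (w k x - W x)\<^sup>2 \<partial>M) \<le> (\<integral>x. 2 * (u k x - W x)\<^sup>2 + 2 * (e k)\<^sup>2 \<partial>M)" for k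
      proof (rule integral_mono_AE)
        show "integrable M (\<lambda>x. (w k x - W x)\<^sup>2)" by (rule L2_diff_sq[OF L2_nice[OF w] W])
        show "integrable M (\<lambda>x. 2 * (u k x - W x)\<^sup>2 + 2 * (e k)\<^sup>2)"
          using L2_diff_sq[OF L2_nice[OF un] W] by simp
        show "AE x in M. (w k x - W x)\<^sup>2 \<le> 2 * (u k x - W x)\<^sup>2 + 2 * (e k)\<^sup>2"
          using assms(2)
        proof eventually_elim
          case (elim x)
          have "\<bar>w k x - W x\<bar> \<le> \<bar>u k x - W x\<bar> + e k"
            unfolding w_def using elim e[of k] by (intro reg_dist) auto
          then have "(w k x - W x)\<^sup>2 \<le> (\<bar>u k x - W x\<bar> + e k)\<^sup>2"
            using power_mono[of "\<bar>w k x - W x\<bar>" _ 2] by simp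
          also have "\<dots> \<le> 2 * (u k x - W x)\<^sup>2 + 2 * (e k)\<^sup>2"
            using sum_squares_bound[of "\<bar>u k x - W x\<bar>" "e k"] unfolding power2_sum power2_abs by linarith
          finally show ?case .
        qed
      qed
      also have "(\<integral>x. 2 * (u k x - W x)\<^sup>2 + 2 * (e k)\<^sup>2 \<partial>M) =
          2 * (\<integral>x. (u k x - W x)\<^sup>2 \<partial>M) + 2 * (e k)\<^sup>2" for k
        using L2_diff_sq[OF L2_nice[OF un] W] by (simp add: prob_space)
      finally show "\<forall>\<^sub>F k in sequentially. norm (\<integral>x. (w k x - W x)\<^sup>2 \<partial>M) \<le>
          2 * (\<integral>x. (u k x - W x)\<^sup>2 \<partial>M) + 2 * (e k)\<^sup>2" by simp
      have "(\<lambda>k. \<integral>x. (u k x - W x)\<^sup>2 \<partial>M) \<longlonglongrightarrow> 0" using u by (simp add: form_approx_def)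
      then have "(\<lambda>k. 2 * (\<integral>x. (u k x - W x)\<^sup>2 \<partial>M) + 2 * (e k)\<^sup>2) \<longlonglongrightarrow> 2 * 0 + 2 * 0\<^sup>2"
        by (intro tendsto_intros elim)
      then show "(\<lambda>k. 2 * (\<integral>x. (u k x - W x)\<^sup>2 \<partial>M) + 2 * (e k)\<^sup>2) \<longlonglongrightarrow> 0" by simp
    qed
  qed
  then show thesis by (rule that) (simp add: w_def reg_ge_1)
qed

section \<open>Energy of the quotient and passage to the limit\<close>

text \<open>With \<open>a = grad f\<close> and \<open>b = (f / w) grad w\<close> the integrand on
  the left is \<open>2 a.b - |b|^2 = |a|^2 - |a - b|^2\<close>.\<close>

lemma dform_quotient_le:
  assumes f: "f \<in> nice" and w: "w \<in> nice" "\<And>x. w x \<ge> 1"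
  shows "dform M w (\<lambda>x. (f x)\<^sup>2 * inverse (w x)) \<le> dform M f f"
proof -
  have w0: "w x \<noteq> 0" for x using w(2)[of x] by auto
  have g: "(\<lambda>x. (f x)\<^sup>2 * inverse (w x)) \<in> nice"
    unfolding power2_eq_square by (intro nice.mult f nice_inverse w w0)
  show ?thesis unfolding dform_def
  proof (rule integral_mono[OF integrable_grad[OF w(1) g] integrable_grad[OF f f]])
    fix x
    let ?a = "grad f x" and ?b = "(f x / w x) *\<^sub>R grad w x"
    have "grad w x \<bullet> grad (\<lambda>x. (f x)\<^sup>2 * inverse (w x)) x = 2 * (?a \<bullet> ?b) - ?b \<bullet> ?b"
      unfolding grad_quotient[OF f w(1) w0]
      by (simp add: inner_diff_right inner_commute power2_eq_square)
    moreover have "0 \<le> (?a - ?b) \<bullet> (?a - ?b)" by simp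
    moreover have "(?a - ?b) \<bullet> (?a - ?b) = ?a \<bullet> ?a - 2 * (?a \<bullet> ?b) + ?b \<bullet> ?b"
      by (simp only: inner_diff_left inner_diff_right inner_commute[of ?b ?a])
    ultimately show "grad w x \<bullet> grad (\<lambda>x. (f x)\<^sup>2 * inverse (w x)) x \<le> ?a \<bullet> ?a" by linarith
  qed
qed

text \<open>Bounds the energy of the test functions uniformly along an approximating sequence, whose
  energies are bounded. The gradient is a difference of \<open>2 q grad f\<close> and
  \<open>q^2 grad w\<close> with \<open>q = f / w\<close>, and \<open>|q| <= F\<close> because
  \<open>w >= 1\<close>.\<close>

lemma dform_quotient_bound:
  assumes f: "f \<in> nice" "\<And>x. \<bar>f x\<bar> \<le> F" and w: "w \<in> nice" "\<And>x. w x \<ge> 1"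
  defines "g \<equiv> \<lambda>x. (f x)\<^sup>2 * inverse (w x)"
  shows "dform M g g \<le> 8 * F\<^sup>2 * dform M f f + 2 * F ^ 4 * dform M w w"
proof -
  have w0: "w x \<noteq> 0" for x using w(2)[of x] by auto
  have F: "F \<ge> 0" using f(2)[of 0] by linarith
  have g: "g \<in> nice"
    unfolding g_def power2_eq_square by (intro nice.mult f nice_inverse w w0)
  have "dform M g g \<le> (\<integral>x. 8 * F\<^sup>2 * (grad f x \<bullet> grad f x) + 2 * F ^ 4 * (grad w x \<bullet> grad w x) \<partial>M)"
    unfolding dform_def
  proof (rule integral_mono[OF integrable_grad[OF g g]])
    show "integrable M (\<lambda>x. 8 * F\<^sup>2 * (grad f x \<bullet> grad f x) + 2 * F ^ 4 * (grad w x \<bullet> grad w x))"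
      using integrable_grad[OF f(1) f(1)] integrable_grad[OF w(1) w(1)] by simp
    fix x
    let ?q = "f x / w x"
    have q: "\<bar>?q\<bar> \<le> F"
    proof -
      have "\<bar>?q\<bar> \<le> \<bar>f x\<bar> / 1" unfolding abs_divide using w(2)[of x] by (intro divide_left_mono) auto
      then show ?thesis using f(2)[of x] by simp
    qed
    have q2: "?q\<^sup>2 \<le> F\<^sup>2" using q F by (metis abs_ge_zero power2_abs power_mono)
    have q4: "?q ^ 4 \<le> F ^ 4" using power_mono[OF q2, of 2] by (simp flip: power_mult)
    let ?a = "(2 * ?q) *\<^sub>R grad f x" and ?b = "?q\<^sup>2 *\<^sub>R grad w x"
    have "grad g x = ?a - ?b"
      unfolding g_def using grad_quotient[OF f(1) w(1) w0] by simp
    \<comment> \<open>Parallelogram law: dropping the last square leaves twice the sum of the two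
      squares, whence the constants 8 and 2.\<close>
    then have "grad g x \<bullet> grad g x = 2 * (?a \<bullet> ?a) + 2 * (?b \<bullet> ?b) - (?a + ?b) \<bullet> (?a + ?b)"
      by (simp only: inner_diff_left inner_diff_right inner_add_left inner_add_right inner_commute[of ?b ?a])
    also have "\<dots> \<le> 2 * (?a \<bullet> ?a) + 2 * (?b \<bullet> ?b)" using inner_ge_zero[of "?a + ?b"] by linarith
    also have "\<dots> = 8 * ?q\<^sup>2 * (grad f x \<bullet> grad f x) + 2 * ?q ^ 4 * (grad w x \<bullet> grad w x)"
      by (simp add: power2_eq_square power4_eq_xxxx)
    also have "\<dots> \<le> 8 * F\<^sup>2 * (grad f x \<bullet> grad f x) + 2 * F ^ 4 * (grad w x \<bullet> grad w x)"
      using q2 q4 by (intro add_mono mult_right_mono mult_left_mono) auto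
    finally show "grad g x \<bullet> grad g x \<le> \<dots>" .
  qed
  also have "\<dots> = 8 * F\<^sup>2 * dform M f f + 2 * F ^ 4 * dform M w w"
    unfolding dform_def using integrable_grad[OF f(1) f(1)] integrable_grad[OF w(1) w(1)] by simp
  finally show ?thesis .
qed

text \<open>A nice \<open>g\<close> approximates itself, so the closed form at \<open>(W, g)\<close>
  is a limit of \<open>dform\<close> in which only the first argument moves.\<close>

lemma generator_nice_right:
  assumes "(W, LW) \<in> generator M" "form_approx M W w" "g \<in> nice"
  shows "(\<lambda>j. dform M (w j) g) \<longlonglongrightarrow> - (\<integral>x. LW x * g x \<partial>M)"
proof -
  have W: "W \<in> L2 M" using assms(1) by (simp add: generator_def form_dom_def)
  have "g \<in> form_dom M" using assms(3) L2_nice approx_self by (auto simp: form_dom_def)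
  then have "closed_form M W g = - (\<integral>x. LW x * g x \<partial>M)" using assms(1) by (simp add: generator_def)
  with closed_form_tendsto[OF W L2_nice[OF assms(3)] assms(2) approx_self[OF assms(3)]]
  show ?thesis by simp
qed

text \<open>Formally, integration by parts against \<open>f\<^sup>2 / W\<close> followed by
  \<open>2 (f / W) \<nabla>f \<bullet> \<nabla>W - (f / W)\<^sup>2 |\<nabla>W|\<^sup>2 \<le> |\<nabla>f|\<^sup>2\<close>.\<close>

lemma lyapunov_form_bound:
  assumes gen: "(W, LW) \<in> generator M" and W1: "AE x in M. W x \<ge> 1" and f: "f \<in> nice"
  shows "integrable M (\<lambda>x. LW x * ((f x)\<^sup>2 * inverse (W x)))"
    and "- (\<integral>x. LW x * ((f x)\<^sup>2 * inverse (W x)) \<partial>M) \<le> dform M f f"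
proof -
  have Wd: "W \<in> form_dom M" and W: "W \<in> L2 M" and LW: "LW \<in> L2 M"
    using gen by (auto simp: generator_def form_dom_def)
  obtain w where w: "form_approx M W w" and w1: "\<And>k x. w k x \<ge> 1"
    using form_approx_ge_1[OF Wd W1] by blast
  note wn = approx_nice[OF w]
  have w0: "w k x \<noteq> 0" for k x using w1[of k x] by auto
  obtain F where F: "\<And>x. \<bar>f x\<bar> \<le> F" using nice_bounded[OF f] by blast
  have f2: "(f x)\<^sup>2 \<le> F\<^sup>2" for x using F[of x] by (metis abs_ge_zero power2_abs power_mono)
  define p where "p x = (f x)\<^sup>2 * inverse (W x)" for x
  define g where "g k x = (f x)\<^sup>2 * inverse (w k x)" for k x
  have g: "g k \<in> nice" for k
    unfolding g_def[abs_def] power2_eq_square by (intro nice.mult f nice_inverse wn w0)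
  have fm: "f \<in> borel_measurable M" and Wm: "W \<in> borel_measurable M"
    using L2_nice[OF f] W by (auto simp: L2_def)
  \<comment> \<open>The limit \<open>p\<close> is never placed in the form domain: the form is
    evaluated at the \<open>g k\<close> only, while pairing with \<open>LW\<close> asks just for
    \<open>p\<close> in \<open>L2 M\<close>.\<close>
  have pL: "p \<in> L2 M"
  proof -
    have pm: "p \<in> borel_measurable M" unfolding p_def[abs_def] using fm Wm by measurable
    have "AE x in M. norm ((p x)\<^sup>2) \<le> (F\<^sup>2)\<^sup>2"
      using W1
    proof eventually_elim
      case (elim x)
      have "p x \<le> F\<^sup>2 * 1" unfolding p_def
        using elim f2[of x] by (intro mult_mono) (auto simp: inverse_le_1_iff)
      moreover have "p x \<ge> 0" using elim by (simp add: p_def)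
      ultimately show ?case using power_mono[of "p x" "F\<^sup>2" 2] by simp
    qed
    then have "integrable M (\<lambda>x. (p x)\<^sup>2)" by (rule integrable_const_bound) (use pm in measurable)
    with pm show ?thesis by (simp add: L2_def)
  qed
  show "integrable M (\<lambda>x. LW x * ((f x)\<^sup>2 * inverse (W x)))"
    using L2_mult_integrable[OF LW pL] by (simp add: p_def)
  have vL: "(\<lambda>x. g k x - p x) \<in> L2 M" for k
    using L2_diff_sq[OF L2_nice[OF g, of k] pL] L2_nice[OF g, of k] pL
    by (simp add: L2_def borel_measurable_diff)
  \<comment> \<open>Inversion is 1-Lipschitz on values at least 1 and \<open>f\<^sup>2\<close> is at
    most \<open>F\<^sup>2\<close>, so convergence of \<open>w k\<close> to \<open>W\<close> carries
    over to the quotients.\<close>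
  have vlim: "(\<lambda>k. \<integral>x. (g k x - p x)\<^sup>2 \<partial>M) \<longlonglongrightarrow> 0"
  proof (rule Lim_null_comparison)
    have "(\<integral>x. (g k x - p x)\<^sup>2 \<partial>M) \<le> (\<integral>x. (F\<^sup>2)\<^sup>2 * (w k x - W x)\<^sup>2 \<partial>M)" for k
    proof (rule integral_mono_AE)
      show "integrable M (\<lambda>x. (g k x - p x)\<^sup>2)" using vL by (simp add: L2_def)
      show "integrable M (\<lambda>x. (F\<^sup>2)\<^sup>2 * (w k x - W x)\<^sup>2)"
        using L2_diff_sq[OF L2_nice[OF wn] W] by simp
      show "AE x in M. (g k x - p x)\<^sup>2 \<le> (F\<^sup>2)\<^sup>2 * (w k x - W x)\<^sup>2"
        using W1
      proof eventually_elim
        case (elim x)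
        have "\<bar>inverse (w k x) - inverse (W x)\<bar> = \<bar>w k x - W x\<bar> / (w k x * W x)"
          using elim w1[of k x] w0[of k x] by (simp add: inverse_diff_inverse abs_mult divide_inverse abs_minus_commute)
        also have "\<dots> \<le> \<bar>w k x - W x\<bar> / 1"
          using elim w1[of k x] mult_mono[of 1 "w k x" 1 "W x"] by (intro divide_left_mono) auto
        finally have i: "\<bar>inverse (w k x) - inverse (W x)\<bar> \<le> \<bar>w k x - W x\<bar>" by simp
        have "\<bar>g k x - p x\<bar> = (f x)\<^sup>2 * \<bar>inverse (w k x) - inverse (W x)\<bar>"
          by (simp add: g_def p_def abs_mult flip: right_diff_distrib)
        also have "\<dots> \<le> F\<^sup>2 * \<bar>w k x - W x\<bar>" using i f2[of x] by (intro mult_mono) auto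
        finally have "\<bar>g k x - p x\<bar>\<^sup>2 \<le> (F\<^sup>2 * \<bar>w k x - W x\<bar>)\<^sup>2" by (intro power_mono) auto
        then show ?case by (simp add: power_mult_distrib)
      qed
    qed
    then show "\<forall>\<^sub>F k in sequentially. norm (\<integral>x. (g k x - p x)\<^sup>2 \<partial>M) \<le>
        (F\<^sup>2)\<^sup>2 * (\<integral>x. (w k x - W x)\<^sup>2 \<partial>M)" by simp
    show "(\<lambda>k. (F\<^sup>2)\<^sup>2 * (\<integral>x. (w k x - W x)\<^sup>2 \<partial>M)) \<longlonglongrightarrow> 0"
      by (rule tendsto_mult_right_zero) (use w in \<open>simp add: form_approx_def\<close>)
  qed
  have "(\<lambda>k. \<integral>x. LW x * (g k x - p x) \<partial>M) \<longlonglongrightarrow> 0"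
    by (rule L2_mult_tendsto_0[OF LW vL vlim])
  then have "(\<lambda>k. (\<integral>x. LW x * g k x \<partial>M) - (\<integral>x. LW x * p x \<partial>M)) \<longlonglongrightarrow> 0"
    using L2_mult_integrable[OF LW L2_nice[OF g]] L2_mult_integrable[OF LW pL]
    by (simp add: right_diff_distrib)
  then have glim: "(\<lambda>k. - (\<integral>x. LW x * g k x \<partial>M)) \<longlonglongrightarrow> - (\<integral>x. LW x * p x \<partial>M)"
    by (rule tendsto_minus[OF LIM_zero_cancel])
  obtain B where B: "B > 0" "\<And>k. fnorm M (w k) \<le> B" using approx_bounded[OF w] by blast
  \<comment> \<open>A bound on the form norm of \<open>g k\<close> independent of \<open>k\<close>;
    the added 1 makes \<open>C\<close> positive even if the root vanishes, as \<open>e / C\<close>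
    is needed next.\<close>
  define C where "C = sqrt (8 * F\<^sup>2 * dform M f f + 2 * F ^ 4 * B\<^sup>2) + 1"
  have gC: "fnorm M (g k) \<le> C" for k
  proof -
    have "dform M (w k) (w k) \<le> B\<^sup>2"
      using B(2)[of k] by (simp add: fnorm_def sqrt_le_D)
    then have "2 * F ^ 4 * dform M (w k) (w k) \<le> 2 * F ^ 4 * B\<^sup>2" by (intro mult_left_mono) auto
    then have "dform M (g k) (g k) \<le> 8 * F\<^sup>2 * dform M f f + 2 * F ^ 4 * B\<^sup>2"
      using dform_quotient_bound[OF f F wn w1, of k] by (simp add: g_def[abs_def])
    then have "fnorm M (g k) \<le> sqrt (8 * F\<^sup>2 * dform M f f + 2 * F ^ 4 * B\<^sup>2)"
      unfolding fnorm_def by (rule real_sqrt_le_mono)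
    then show ?thesis by (simp add: C_def)
  qed
  have C: "C > 0" using dform_nonneg[of f] by (auto simp: C_def intro!: add_nonneg_pos)
  \<comment> \<open>Two successive limits: for fixed \<open>k\<close>, letting \<open>j\<close> grow
    in \<open>dform M (w j) (g k)\<close> produces \<open>LW\<close>; afterwards \<open>k\<close>
    grows and \<open>g k\<close> tends to \<open>p\<close>.\<close>
  have "- (\<integral>x. LW x * p x \<partial>M) \<le> dform M f f + e" if e: "e > 0" for e
  proof -
    have "e / C > 0" using e C by simp
    from approx_Cauchy[OF w this]
    obtain N where N: "\<forall>j\<ge>N. \<forall>k\<ge>N. fnorm M (\<lambda>x. w j x - w k x) < e / C" by blast
    have "- (\<integral>x. LW x * g k x \<partial>M) \<le> dform M f f + e" if k: "k \<ge> N" for k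
    proof (rule LIMSEQ_le_const2[OF generator_nice_right[OF gen w g]])
      have "dform M (w j) (g k) \<le> dform M f f + e" if j: "j \<ge> N" for j
      proof -
        \<comment> \<open>The square is completed only when \<open>w k\<close> meets its own
          quotient \<open>g k\<close>. The mismatch of indices costs at most
          \<open>e / C * C\<close>.\<close>
        have "dform M (w j) (g k) = dform M (w k) (g k) + dform M (\<lambda>x. w j x - w k x) (g k)"
          by (simp add: dform_diff wn g)
        moreover have "dform M (w k) (g k) \<le> dform M f f"
          using dform_quotient_le[OF f wn w1] by (simp add: g_def[abs_def])
        moreover have "dform M (\<lambda>x. w j x - w k x) (g k) \<le> e"
        proof -
          have "dform M (\<lambda>x. w j x - w k x) (g k) \<le> fnorm M (\<lambda>x. w j x - w k x) * fnorm M (g k)"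
            using CS[OF nice_diff[OF wn wn] g, of j k k] by linarith
          also have "\<dots> \<le> e / C * C"
            using N j k gC[of k] e C by (intro mult_mono) (auto simp: fnorm_nonneg less_imp_le)
          also have "\<dots> = e" using C by simp
          finally show ?thesis .
        qed
        ultimately show ?thesis by linarith
      qed
      then show "\<exists>N. \<forall>j\<ge>N. dform M (w j) (g k) \<le> dform M f f + e" by blast
    qed
    then show ?thesis by (intro LIMSEQ_le_const2[OF glim]) blast
  qed
  then show "- (\<integral>x. LW x * ((f x)\<^sup>2 * inverse (W x)) \<partial>M) \<le> dform M f f"
    unfolding p_def by (rule field_le_epsilon)
qed

end

section \<open>Mass of the ball and the global inequality\<close>

text \<open>The density is positive everywhere, so a null ball would be Lebesgue null. Positivity
  allows dividing by this mass to form the mean over the ball.\<close>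

lemma gibbs_cball_pos:
  fixes V :: "real ^ 'n \<Rightarrow> real"
  assumes "smooth V" "prob_space (gibbs Z V)" "R > 0"
  shows "measure (gibbs Z V) {x. norm x \<le> R} > 0"
proof -
  interpret prob_space "gibbs Z V" by fact
  have c: "{x. norm x \<le> R} = cball (0 :: real ^ 'n) R" by auto
  have m: "(\<lambda>x. ennreal (Z * exp (- V x))) \<in> borel_measurable lborel"
    using smooth_continuous[OF assms(1)]
    by (intro measurable_compose[OF _ measurable_ennreal])
       (auto intro!: borel_measurable_continuous_onI continuous_intros)
  have "emeasure (gibbs Z V) (cball 0 R) \<noteq> 0"
  proof
    assume "emeasure (gibbs Z V) (cball 0 R) = 0"
    then have "AE x in gibbs Z V. x \<notin> cball 0 R"
      by (intro AE_not_in) auto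
    then have "AE x in lborel. x \<notin> cball (0 :: real ^ 'n) R"
      unfolding gibbs_def AE_density[OF m] using gibbs_pos[OF assms(2)] by (simp add: ennreal_less_zero_iff)
    then have "emeasure lborel (cball (0 :: real ^ 'n) R) = 0"
      by (subst (asm) AE_iff_measurable[of "cball 0 R"]) auto
    then have "measure lborel (cball (0 :: real ^ 'n) R) = 0" by (simp add: measure_def)
    with content_cball_pos[OF assms(3), of "0 :: real ^ 'n"] show False by simp
  qed
  then show ?thesis unfolding c by (simp add: emeasure_eq_measure zero_less_measure_iff)
qed

theorem theorem3p1:
  fixes V W LW :: "real ^ 'n \<Rightarrow> real" and Z lam b R kappa :: real
  assumes "smooth V"
    and "prob_space (gibbs Z V)"
    and "(W, LW) \<in> generator (gibbs Z V)"
    and "AE x in gibbs Z V. W x \<ge> 1"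
    and "lam > 0" and "b > 0" and "R > 0"
    and "AE x in gibbs Z V. LW x \<le> - lam * W x + b * indicator {x. norm x \<le> R} x"
    and "\<forall>f\<in>nice.
           (LINT x:{x. norm x \<le> R}|gibbs Z V. (f x)\<^sup>2)
             \<le> kappa * (\<integral>x. carre_du_champ f x \<partial>gibbs Z V)
               + inverse (measure (gibbs Z V) {x. norm x \<le> R})
                 * (LINT x:{x. norm x \<le> R}|gibbs Z V. f x)\<^sup>2"
  shows "\<forall>f\<in>nice. Var (gibbs Z V) f
           \<le> (b * kappa + 1) / lam * (\<integral>x. carre_du_champ f x \<partial>gibbs Z V)"
proof
  fix f :: "real ^ 'n \<Rightarrow> real" assume f: "f \<in> nice"
  define M where "M = gibbs Z V"
  note ctx = assms(1,2) M_def
  interpret prob_space M unfolding M_def by fact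
  define B where "B = {x :: real ^ 'n. norm x \<le> R}"
  have Bc: "B = cball 0 R" by (auto simp: B_def)
  have Bs[measurable]: "B \<in> sets M" by (simp add: M_def Bc)
  have Bpos: "measure M B > 0" unfolding M_def B_def by (rule gibbs_cball_pos) fact+
  have int_nice: "integrable M h" if "h \<in> nice" for h
    using bounded_integrable[OF ctx smooth_continuous[OF nice_smooth[OF that]] nice_bounded[OF that]] .
  have set_int: "set_integrable M B h" if "h \<in> nice" for h
    unfolding set_integrable_def using int_nice[OF that] Bs by (intro integrable_mult_indicator) auto
  \<comment> \<open>The mean over the ball: after subtracting it, the squared integral in the local
    inequality is zero, while the gradient is unchanged.\<close>
  define c where "c = (LINT x:B|M. f x) / measure M B"
  define g where "g x = f x - c" for x
  have g: "g \<in> nice" unfolding g_def[abs_def] by (intro nice_diff f nice.const)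
  have g2: "(\<lambda>x. (g x)\<^sup>2) \<in> nice" unfolding power2_eq_square by (intro nice.mult g)
  have grad_g: "grad g x = grad f x" for x
  proof -
    have "((\<lambda>t. t - c) has_real_derivative 1 - 0) (at (f x))"
      by (intro DERIV_diff DERIV_ident DERIV_const)
    from grad_chain[OF smooth_differentiable[OF nice_smooth[OF f]] this] show ?thesis
      by (simp add: g_def[abs_def])
  qed
  define D where "D = (\<integral>x. carre_du_champ f x \<partial>M)"
  have D: "dform M g g = D" "(\<integral>x. carre_du_champ g x \<partial>M) = D"
    by (simp_all add: D_def dform_def carre_du_champ_def grad_g power2_norm_eq_inner)
  have "(LINT x:B|M. g x) = (LINT x:B|M. f x) - (LINT x:B|M. c)"
    unfolding g_def by (intro set_integral_diff set_int f nice.const)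
  also have "(LINT x:B|M. c) = measure M B * c"
    unfolding set_lebesgue_integral_def using Bs by simp
  finally have "(LINT x:B|M. g x) = 0" using Bpos by (simp add: c_def)
  then have loc: "(LINT x:B|M. (g x)\<^sup>2) \<le> kappa * D"
    using assms(9)[folded M_def B_def, rule_format, OF g] D by simp
  note lb = lyapunov_form_bound[OF ctx assms(3)[folded M_def] assms(4)[folded M_def] g]
  have "(\<integral>x. lam * (g x)\<^sup>2 \<partial>M) \<le>
      (\<integral>x. - (LW x * ((g x)\<^sup>2 * inverse (W x))) + b * (indicator B x * (g x)\<^sup>2) \<partial>M)"
  proof (rule integral_mono_AE)
    show "integrable M (\<lambda>x. lam * (g x)\<^sup>2)" using int_nice[OF g2] by simp
    show "integrable M (\<lambda>x. - (LW x * ((g x)\<^sup>2 * inverse (W x))) + b * (indicator B x * (g x)\<^sup>2))"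
      using lb(1) set_int[OF g2] unfolding set_integrable_def by simp
    show "AE x in M. lam * (g x)\<^sup>2 \<le> - (LW x * ((g x)\<^sup>2 * inverse (W x))) + b * (indicator B x * (g x)\<^sup>2)"
      using assms(4,8)[folded M_def B_def]
    proof eventually_elim
      case (elim x)
      let ?p = "(g x)\<^sup>2 * inverse (W x)"
      have p: "?p \<ge> 0" "?p \<le> (g x)\<^sup>2" "W x * ?p = (g x)\<^sup>2"
        using elim(1) mult_left_mono[of "inverse (W x)" 1 "(g x)\<^sup>2"] by (auto simp: inverse_le_1_iff)
      \<comment> \<open>Multiplying the Lyapunov condition by \<open>?p\<close> turns
        \<open>lam * W x\<close> into \<open>lam * (g x)\<^sup>2\<close>; in the ball term
        \<open>?p\<close> is then enlarged to \<open>(g x)\<^sup>2\<close>, using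
        \<open>b > 0\<close>.\<close>
      have "LW x * ?p \<le> (- lam * W x + b * indicator B x) * ?p"
        using elim(2) p(1) by (rule mult_right_mono)
      also have "\<dots> = - lam * (W x * ?p) + b * indicator B x * ?p" by (simp add: algebra_simps)
      also have "\<dots> \<le> - lam * (g x)\<^sup>2 + b * indicator B x * (g x)\<^sup>2"
        unfolding p(3) using p(2) assms(6) by (intro add_left_mono mult_left_mono) auto
      finally show ?case by (simp add: algebra_simps)
    qed
  qed
  also have "\<dots> = - (\<integral>x. LW x * ((g x)\<^sup>2 * inverse (W x)) \<partial>M) + b * (LINT x:B|M. (g x)\<^sup>2)"
    using lb(1) set_int[OF g2] unfolding set_integrable_def set_lebesgue_integral_def by simp
  also have "\<dots> \<le> D + b * (kappa * D)"
    using lb(2) D(1) loc assms(6) by (intro add_mono mult_left_mono) auto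
  finally have "lam * (\<integral>x. (g x)\<^sup>2 \<partial>M) \<le> (b * kappa + 1) * D" by (simp add: algebra_simps)
  then have main: "(\<integral>x. (g x)\<^sup>2 \<partial>M) \<le> (b * kappa + 1) / lam * D"
    using assms(5) by (simp add: field_simps)
  have f2: "(\<lambda>x. (f x)\<^sup>2) \<in> nice" unfolding power2_eq_square by (intro nice.mult f)
  have "(\<integral>x. (g x)\<^sup>2 \<partial>M) = (\<integral>x. (f x)\<^sup>2 - 2 * c * f x + c\<^sup>2 \<partial>M)"
    by (simp add: g_def power2_diff algebra_simps)
  also have "\<dots> = (\<integral>x. (f x)\<^sup>2 \<partial>M) - 2 * c * (\<integral>x. f x \<partial>M) + c\<^sup>2"
    using int_nice[OF f] int_nice[OF f2] by (simp add: prob_space)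
  \<comment> \<open>The second moment about any \<open>c\<close> exceeds the variance by the squared
    distance from \<open>c\<close> to the mean, so centring at the mean over the ball loses nothing
    in the required direction.\<close>
  finally have "Var M f + ((\<integral>x. f x \<partial>M) - c)\<^sup>2 = (\<integral>x. (g x)\<^sup>2 \<partial>M)"
    by (simp add: Var_def power2_diff algebra_simps)
  then have "Var M f \<le> (b * kappa + 1) / lam * D"
    using main zero_le_power2[of "(\<integral>x. f x \<partial>M) - c"] by linarith
  then show "Var (gibbs Z V) f \<le> (b * kappa + 1) / lam * (\<integral>x. carre_du_champ f x \<partial>gibbs Z V)"
    by (simp add: M_def D_def)
qed

end
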